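(* Let $F$ be a bounded free holomorphic function on the polyball with coefficients $\{A_{(\boldsymbol\alpha)}\}$ in $B(\mathcal K)$ such that $\|F\|_\infty\le1$ and $A_0=a_0I$ for some $a_0\in\mathbb C$. (i) If $\boldsymbol\rho=(\rho_{i,j})$ with $\rho_{i,j}=r_i\in[0,1)$ for all $j\in\{1,\dots,n_i\}$, then for every Hilbert space $\mathcal H$ and every $\mathbf X\in\boldsymbol\rho\mathbf B_{\mathbf n}(\mathcal H)^-$, $$\sum_{\mathbf p\in\mathbb Z_+^k}\Big\|\sum_{\boldsymbol\alpha\in\Lambda_{\mathbf p}}A_{(\boldsymbol\alpha)}\otimes\mathbf X_{\boldsymbol\alpha}\Big\|\le|a_0|+(1-|a_0|^2)\Big[\prod_{i=1}^k(1-r_i)^{-1}-1\Big].$$ Consequently, if $\prod_{i=1}^k(1-r_i)\ge\frac23$, the left-hand side is $\le1$ for all $\mathbf X\in\boldsymbol\rho\mathbf B_{\mathbf n}(\mathcal H)^-$. (ii) The Bohr radius satisfies $1-\left(\frac23\right)^{1/k}\le K_{mh}(\mathbf B_{\mathbf n})\le\frac13$.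
   Context: Fix $k\in\mathbb N$, $\mathbf n=(n_1,\dots,n_k)\in\mathbb N^k$; Hilbert spaces are separable. The regular polyball $\mathbf B_{\mathbf n}(\mathcal H)$ is the set of $\mathbf X=(X_1,\dots,X_k)$, $X_i=(X_{i,1},\dots,X_{i,n_i})\in B(\mathcal H)^{n_i}$, with entries of $X_s$ commuting with entries of $X_t$ for $s\ne t$, $\|\sum_jX_{i,j}X_{i,j}^*\|<1$ for all $i$, and $\Delta_{\mathbf X}(I)$ positive invertible, where $\Delta_{\mathbf X}=(\mathrm{id}-\Phi_{X_1})\circ\cdots\circ(\mathrm{id}-\Phi_{X_k})$, $\Phi_{X_i}(Y)=\sum_jX_{i,j}YX_{i,j}^*$; $\mathbf B_{\mathbf n}(\mathcal H)^-$ is its norm closure. $\mathbb F_{n_i}^+$: free semigroup on $g^i_1,\dots,g^i_{n_i}$ with identity $g^i_0$, $|\alpha|$ word length. For $\alpha=g^i_{j_1}\cdots g^i_{j_p}$, $X_{i,\alpha}=X_{i,j_1}\cdots X_{i,j_p}$ ($X_{i,g^i_0}=I$), $\mathbf X_{\boldsymbol\alpha}=X_{1,\alpha_1}\cdots X_{k,\alpha_k}$; $\mathbf g_0=(g^1_0,\dots,g^k_0)$; $\Lambda_{\mathbf p}=\{\boldsymbol\alpha:|\alpha_i|=p_i\ \forall i\}$ for $\mathbf p\in\mathbb Z_+^k$. Free holomorphic function with coefficients in $B(\mathcal K)$: $\{A_{(\boldsymbol\alpha)}\}\subset B(\mathcal K)$ with $F(\mathbf X)=\sum_{\mathbf p}\sum_{\boldsymbol\alpha\in\Lambda_{\mathbf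 p}}A_{(\boldsymbol\alpha)}\otimes\mathbf X_{\boldsymbol\alpha}$ norm convergent for all $\mathcal H$ and $\mathbf X\in\mathbf B_{\mathbf n}(\mathcal H)$; $A_0=A_{(\mathbf g_0)}$; $\|F\|_\infty=\sup_{\mathcal H,\mathbf X}\|F(\mathbf X)\|$; $H^\infty(\mathbf B_{\mathbf n})$ denotes those with scalar coefficients $a_{(\boldsymbol\alpha)}$ and $\|F\|_\infty<\infty$. For $\boldsymbol\rho=(\rho_{i,j})$, $\boldsymbol\rho\mathbf X=(\rho_{i,j}X_{i,j})$ and $\boldsymbol\rho\mathbf B_{\mathbf n}(\mathcal H)^-=\{\boldsymbol\rho\mathbf X:\mathbf X\in\mathbf B_{\mathbf n}(\mathcal H)^-\}$; $r\mathbf B_{\mathbf n}(\mathcal H)^-$ similarly for scalar $r$. The Bohr radius $K_{mh}(\mathbf B_{\mathbf n})$ is the largest $r\ge0$ such that $\sum_{\mathbf p}\|\sum_{\boldsymbol\alpha\in\Lambda_{\mathbf p}}a_{(\boldsymbol\alpha)}\mathbf X_{\boldsymbol\alpha}\|\le\|F\|_\infty$ for every $F\in H^\infty(\mathbf B_{\mathbf n})$, every Hilbert space $\mathcal H$, and every $\mathbf X\in r\mathbf B_{\mathbf n}(\mathcal H)^-$. *)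

theory Defs
  imports "HOL-Analysis.Analysis"
begin

text \<open>A separable Hilbert space is represented (up to unitary equivalence) as
  l2(D) for an index set D (a subset of nat, or of nat x nat for tensor products);
  an operator is its matrix w.r.t. the standard orthonormal basis.\<close>

type_synonym 'i mat = "'i \<Rightarrow> 'i \<Rightarrow> complex"

definition mnorm_set :: "'i mat \<Rightarrow> real set" where
  "mnorm_set M = {sqrt (\<Sum>i\<in>F. (cmod (\<Sum>j\<in>G. M i j * x j))\<^sup>2) | F G x.
      finite F \<and> finite G \<and> (\<Sum>j\<in>G. (cmod (x j))\<^sup>2) \<le> 1}"

definition mbounded :: "'i mat \<Rightarrow> bool" where
  "mbounded M \<longleftrightarrow> bdd_above (mnorm_set M)"

definition mnorm :: "'i mat \<Rightarrow> real" where
  "mnorm M = Sup (mnorm_set M)"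

definition op_on :: "'i set \<Rightarrow> 'i mat \<Rightarrow> bool" where
  "op_on D M \<longleftrightarrow> mbounded M \<and> (\<forall>i j. (i \<notin> D \<or> j \<notin> D) \<longrightarrow> M i j = 0)"

definition mid :: "'i set \<Rightarrow> 'i mat" where
  "mid D = (\<lambda>i j. if i = j \<and> i \<in> D then 1 else 0)"

definition mmul :: "'i mat \<Rightarrow> 'i mat \<Rightarrow> 'i mat" where
  "mmul A B = (\<lambda>i j. infsum (\<lambda>l. A i l * B l j) UNIV)"

definition madj :: "'i mat \<Rightarrow> 'i mat" where
  "madj A = (\<lambda>i j. cnj (A j i))"

definition msub :: "'i mat \<Rightarrow> 'i mat \<Rightarrow> 'i mat" where
  "msub A B = (\<lambda>i j. A i j - B i j)"

definition smul :: "complex \<Rightarrow> 'i mat \<Rightarrow> 'i mat" where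
  "smul c A = (\<lambda>i j. c * A i j)"

definition msum :: "'a set \<Rightarrow> ('a \<Rightarrow> 'i mat) \<Rightarrow> 'i mat" where
  "msum S T = (\<lambda>i j. \<Sum>a\<in>S. T a i j)"

definition mtensor :: "'k mat \<Rightarrow> 'h mat \<Rightarrow> ('k \<times> 'h) mat" where
  "mtensor A B = (\<lambda>(a, h) (a', h'). A a a' * B h h')"

definition mpos :: "'i set \<Rightarrow> 'i mat \<Rightarrow> bool" where
  "mpos D T \<longleftrightarrow> (\<forall>G x. finite G \<and> G \<subseteq> D \<longrightarrow>
     (let q = (\<Sum>i\<in>G. \<Sum>j\<in>G. cnj (x i) * T i j * x j) in Im q = 0 \<and> Re q \<ge> 0))"

definition minvertible :: "'i set \<Rightarrow> 'i mat \<Rightarrow> bool" where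
  "minvertible D T \<longleftrightarrow> (\<exists>S. op_on D S \<and> mmul T S = mid D \<and> mmul S T = mid D)"

definition mconv :: "(nat \<Rightarrow> 'i mat) \<Rightarrow> 'i mat \<Rightarrow> bool" where
  "mconv P S \<longleftrightarrow> mbounded S \<and> (\<forall>N. mbounded (msub S (P N))) \<and>
     (\<lambda>N. mnorm (msub S (P N))) \<longlonglongrightarrow> 0"

text \<open>A tuple X = (X_1,...,X_k), X_i = (X_{i,1},...,X_{i,n_i}) is encoded as
  X :: nat => nat => nat mat with (0-based) indices i < k, j < n i.\<close>

definition Phi :: "(nat \<Rightarrow> nat mat) \<Rightarrow> nat \<Rightarrow> nat mat \<Rightarrow> nat mat" where
  "Phi Xi ni Y = msum {..<ni} (\<lambda>j. mmul (mmul (Xi j) Y) (madj (Xi j)))"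

definition Delta :: "nat \<Rightarrow> (nat \<Rightarrow> nat) \<Rightarrow> (nat \<Rightarrow> nat \<Rightarrow> nat mat) \<Rightarrow> nat mat \<Rightarrow> nat mat" where
  "Delta k n X Y = foldr (\<lambda>i Z. msub Z (Phi (X i) (n i) Z)) [0..<k] Y"

definition polyball :: "nat \<Rightarrow> (nat \<Rightarrow> nat) \<Rightarrow> nat set \<Rightarrow> (nat \<Rightarrow> nat \<Rightarrow> nat mat) \<Rightarrow> bool" where
  "polyball k n D X \<longleftrightarrow>
     (\<forall>i<k. \<forall>j<n i. op_on D (X i j)) \<and>
     (\<forall>s<k. \<forall>t<k. s \<noteq> t \<longrightarrow> (\<forall>a<n s. \<forall>b<n t. mmul (X s a) (X t b) = mmul (X t b) (X s a))) \<and>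
     (\<forall>i<k. mnorm (msum {..<n i} (\<lambda>j. mmul (X i j) (madj (X i j)))) < 1) \<and>
     mpos D (Delta k n X (mid D)) \<and> minvertible D (Delta k n X (mid D))"

definition polyball_cl :: "nat \<Rightarrow> (nat \<Rightarrow> nat) \<Rightarrow> nat set \<Rightarrow> (nat \<Rightarrow> nat \<Rightarrow> nat mat) \<Rightarrow> bool" where
  "polyball_cl k n D X \<longleftrightarrow>
     (\<forall>i<k. \<forall>j<n i. op_on D (X i j)) \<and>
     (\<forall>\<epsilon>>0. \<exists>Y. polyball k n D Y \<and> (\<forall>i<k. \<forall>j<n i. mnorm (msub (X i j) (Y i j)) < \<epsilon>))"

definition scaled_cl :: "nat \<Rightarrow> (nat \<Rightarrow> nat) \<Rightarrow> (nat \<Rightarrow> nat \<Rightarrow> real) \<Rightarrow> nat set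
    \<Rightarrow> (nat \<Rightarrow> nat \<Rightarrow> nat mat) \<Rightarrow> bool" where
  "scaled_cl k n \<rho> D X \<longleftrightarrow> (\<exists>Y. polyball_cl k n D Y \<and>
     (\<forall>i<k. \<forall>j<n i. X i j = smul (complex_of_real (\<rho> i j)) (Y i j)))"

text \<open>A tuple of words alpha = (alpha_1,...,alpha_k), alpha_i a word in the free semigroup
  on n_i generators, is encoded as alpha :: nat => nat list (letters j < n i),
  with alpha i = [] for i >= k.\<close>
definition tup :: "nat \<Rightarrow> (nat \<Rightarrow> nat) \<Rightarrow> (nat \<Rightarrow> nat list) \<Rightarrow> bool" where
  "tup k n \<alpha> \<longleftrightarrow> (\<forall>i<k. \<forall>c\<in>set (\<alpha> i). c < n i) \<and> (\<forall>i\<ge>k. \<alpha> i = [])"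

definition Lam :: "nat \<Rightarrow> (nat \<Rightarrow> nat) \<Rightarrow> (nat \<Rightarrow> nat) \<Rightarrow> (nat \<Rightarrow> nat list) set" where
  "Lam k n p = {\<alpha>. tup k n \<alpha> \<and> (\<forall>i<k. length (\<alpha> i) = p i)}"

definition DegSet :: "nat \<Rightarrow> (nat \<Rightarrow> nat) \<Rightarrow> nat \<Rightarrow> (nat \<Rightarrow> nat list) set" where
  "DegSet k n q = {\<alpha>. tup k n \<alpha> \<and> (\<Sum>i<k. length (\<alpha> i)) = q}"

definition Mindex :: "nat \<Rightarrow> (nat \<Rightarrow> nat) set" where
  "Mindex k = {p. \<forall>i\<ge>k. p i = 0}"

definition g0 :: "nat \<Rightarrow> nat list" where
  "g0 = (\<lambda>_. [])"

definition wprod :: "nat set \<Rightarrow> (nat \<Rightarrow> nat mat) \<Rightarrow> nat list \<Rightarrow> nat mat" where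
  "wprod D Xi ws = foldr (\<lambda>j M. mmul (Xi j) M) ws (mid D)"

definition mono :: "nat \<Rightarrow> nat set \<Rightarrow> (nat \<Rightarrow> nat \<Rightarrow> nat mat) \<Rightarrow> (nat \<Rightarrow> nat list) \<Rightarrow> nat mat" where
  "mono k D X \<alpha> = foldr (\<lambda>i M. mmul (wprod D (X i) (\<alpha> i)) M) [0..<k] (mid D)"

definition psums :: "nat \<Rightarrow> (nat \<Rightarrow> nat) \<Rightarrow> ((nat \<Rightarrow> nat list) \<Rightarrow> 'i mat) \<Rightarrow> nat \<Rightarrow> 'i mat" where
  "psums k n T N = msum {..<N} (\<lambda>q. msum (DegSet k n q) T)"

text \<open>Operator-coefficient free holomorphic function on the polyball with coefficients
  A alpha in B(K), K = l2(DK): F(X) = sum A_alpha \<otimes> X_alpha, norm convergent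
  for every Hilbert space H = l2(D) and X in the polyball.\<close>
definition fh_term :: "nat \<Rightarrow> ((nat \<Rightarrow> nat list) \<Rightarrow> nat mat) \<Rightarrow> nat set \<Rightarrow> (nat \<Rightarrow> nat \<Rightarrow> nat mat)
    \<Rightarrow> (nat \<Rightarrow> nat list) \<Rightarrow> (nat \<times> nat) mat" where
  "fh_term k A D X \<alpha> = mtensor (A \<alpha>) (mono k D X \<alpha>)"

definition is_fh :: "nat \<Rightarrow> (nat \<Rightarrow> nat) \<Rightarrow> nat set \<Rightarrow> ((nat \<Rightarrow> nat list) \<Rightarrow> nat mat) \<Rightarrow> bool" where
  "is_fh k n DK A \<longleftrightarrow> (\<forall>\<alpha>. op_on DK (A \<alpha>)) \<and>
     (\<forall>D X. polyball k n D X \<longrightarrow> (\<exists>S. mconv (psums k n (fh_term k A D X)) S))"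

definition fh_eval :: "nat \<Rightarrow> (nat \<Rightarrow> nat) \<Rightarrow> ((nat \<Rightarrow> nat list) \<Rightarrow> nat mat) \<Rightarrow> nat set
    \<Rightarrow> (nat \<Rightarrow> nat \<Rightarrow> nat mat) \<Rightarrow> (nat \<times> nat) mat" where
  "fh_eval k n A D X = (THE S. mconv (psums k n (fh_term k A D X)) S)"

definition sc_term :: "nat \<Rightarrow> ((nat \<Rightarrow> nat list) \<Rightarrow> complex) \<Rightarrow> nat set \<Rightarrow> (nat \<Rightarrow> nat \<Rightarrow> nat mat)
    \<Rightarrow> (nat \<Rightarrow> nat list) \<Rightarrow> nat mat" where
  "sc_term k a D X \<alpha> = smul (a \<alpha>) (mono k D X \<alpha>)"

definition sc_eval :: "nat \<Rightarrow> (nat \<Rightarrow> nat) \<Rightarrow> ((nat \<Rightarrow> nat list) \<Rightarrow> complex) \<Rightarrow> nat set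
    \<Rightarrow> (nat \<Rightarrow> nat \<Rightarrow> nat mat) \<Rightarrow> nat mat" where
  "sc_eval k n a D X = (THE S. mconv (psums k n (sc_term k a D X)) S)"

definition Hinf :: "nat \<Rightarrow> (nat \<Rightarrow> nat) \<Rightarrow> ((nat \<Rightarrow> nat list) \<Rightarrow> complex) \<Rightarrow> bool" where
  "Hinf k n a \<longleftrightarrow>
     (\<forall>D X. polyball k n D X \<longrightarrow> (\<exists>S. mconv (psums k n (sc_term k a D X)) S)) \<and>
     bdd_above {mnorm (sc_eval k n a D X) | D X. polyball k n D X}"

definition Hinf_norm :: "nat \<Rightarrow> (nat \<Rightarrow> nat) \<Rightarrow> ((nat \<Rightarrow> nat list) \<Rightarrow> complex) \<Rightarrow> real" where
  "Hinf_norm k n a = Sup {mnorm (sc_eval k n a D X) | D X. polyball k n D X}"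

definition bohr_ok :: "nat \<Rightarrow> (nat \<Rightarrow> nat) \<Rightarrow> real \<Rightarrow> bool" where
  "bohr_ok k n r \<longleftrightarrow> (\<forall>a. Hinf k n a \<longrightarrow> (\<forall>D X. scaled_cl k n (\<lambda>_ _. r) D X \<longrightarrow>
     (let h = (\<lambda>p. mnorm (msum (Lam k n p) (sc_term k a D X))) in
        h summable_on Mindex k \<and> infsum h (Mindex k) \<le> Hinf_norm k n a)))"

definition bohr_radius :: "nat \<Rightarrow> (nat \<Rightarrow> nat) \<Rightarrow> real" where
  "bohr_radius k n = Sup {r. 0 \<le> r \<and> bohr_ok k n r}"

end

theory Submission
  imports Defs "HOL-Computational_Algebra.Primes"
begin


text \<open>
  Let \<open>Y\<close> be in the polyball and let \<open>V_1, \<dots>, V_k\<close> be the commuting coisometries of \<open>l2\<close> with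
  \<open>V_i e_(m P_i) = e_m\<close>, where the \<open>P_i\<close> are distinct primes. Then \<open>X_(i,j) = Y_(i,j) \<otimes> V_i\<close> is again
  in the polyball, since \<open>\<Delta>_X(I) = \<Delta>_Y(I) \<otimes> I\<close>, and unique factorization separates the multidegrees:
  compressing \<open>F(X)\<close> to the levels \<open>1\<close> and \<open>\<Prod>_i P_i^(p_i)\<close> yields the operator matrix with rows
  \<open>(a0 I, F_p(Y))\<close> and \<open>(0, a0 I)\<close>, where \<open>F_p\<close> is the homogeneous part of multidegree \<open>p\<close>. A block
  matrix of this form has norm at most \<open>M\<close> only if \<open>\<parallel>F_p(Y)\<parallel> \<le> (M^2 - |a0|^2) / M\<close>. Passing to the
  closure, scaling by \<open>r\<close> and summing the resulting geometric series gives (i) and the lower bound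
  in (ii). The upper bound \<open>1/3\<close> comes from \<open>(a - X_(1,1)) (1 - a X_(1,1))^(-1)\<close> as \<open>a\<close> tends to \<open>1\<close>.
\<close>

section \<open>Matrices as bounded operators\<close>

text \<open>A homogeneous part is usually isolated by averaging over the torus or by passing to the
  universal model on Fock space. Here a single evaluation suffices, because H may be enlarged
  freely. Coisometries serve rather than isometries: X X^* sees the second factor through V V^*, and
  V V^* = I leaves the defining conditions of the polyball intact. Because A_0 is scalar, it maps B
  u to a multiple of B u; this is what makes (t B u, u) a usable test vector for the block matrix.
  The bound M stays general: (i) takes M = 1, the Bohr radius takes M to be the norm of F. With c =
  |a0| one has 1 - c^2 <= 2 (1 - c), so the product minus 1 may be as large as 1/2, hence 2/3 = 1 /
  (1 + 1/2); for k equal radii this reads (1 - r)^k = 2/3. The constant 1/3 solves r / (1 - r) =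
  1/2: for a near 1 the test function gives up 1 - a in the constant term and gains about 2 (1 - a)
  r / (1 - r) in the others.\<close>

text \<open>Carries \<open>mbounded M\<close> and \<open>mnorm M \<le> C\<close> at once. Being
  homogeneous in x and free of suprema, it passes through sums, products and limits without separate
  boundedness conditions.\<close>

definition norm_bound :: "'i mat \<Rightarrow> real \<Rightarrow> bool" where
  "norm_bound M C \<longleftrightarrow> (\<forall>F G x. finite F \<longrightarrow> finite G \<longrightarrow>
     L2_set (\<lambda>i. cmod (\<Sum>j\<in>G. M i j * x j)) F \<le> C * L2_set (\<lambda>j. cmod (x j)) G)"

lemma norm_boundD:
  "norm_bound M C \<Longrightarrow> finite F \<Longrightarrow> finite G \<Longrightarrow>
     L2_set (\<lambda>i. cmod (\<Sum>j\<in>G. M i j * x j)) F \<le> C * L2_set (\<lambda>j. cmod (x j)) G"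
  by (simp add: norm_bound_def)

lemma mbounded_imp_norm_bound:
  assumes "mbounded M" shows "norm_bound M (mnorm M)"
  unfolding norm_bound_def
proof (intro allI impI)
  fix F G :: "'a set" and x :: "'a \<Rightarrow> complex"
  assume fin: "finite F" "finite G"
  define s where "s = L2_set (\<lambda>j. cmod (x j)) G"
  have s0: "s \<ge> 0" by (simp add: s_def)
  show "L2_set (\<lambda>i. cmod (\<Sum>j\<in>G. M i j * x j)) F \<le> mnorm M * L2_set (\<lambda>j. cmod (x j)) G"
  proof (cases "s = 0")
    case True
    then have "\<forall>j\<in>G. x j = 0"
      using fin L2_set_eq_0_iff[of G "\<lambda>j. cmod (x j)"] by (simp add: s_def)
    then show ?thesis using True by (simp add: s_def L2_set_def)
  next
    case False
    then have sp: "s > 0" using s0 by simp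
    define y where "y = (\<lambda>j. x j / complex_of_real s)"
    have "L2_set (\<lambda>j. cmod (y j)) G = L2_set (\<lambda>j. (1/s) * cmod (x j)) G"
      using sp by (intro L2_set_cong) (auto simp: y_def norm_divide)
    also have "\<dots> = (1/s) * s"
      unfolding s_def by (rule L2_set_right_distrib[symmetric]) simp
    finally have "L2_set (\<lambda>j. cmod (y j)) G = 1" using sp by simp
    then have "(\<Sum>j\<in>G. (cmod (y j))\<^sup>2) \<le> 1" by (simp add: L2_set_def)
    then have "L2_set (\<lambda>i. cmod (\<Sum>j\<in>G. M i j * y j)) F \<in> mnorm_set M"
      using fin unfolding mnorm_set_def L2_set_def by blast
    then have le: "L2_set (\<lambda>i. cmod (\<Sum>j\<in>G. M i j * y j)) F \<le> mnorm M"
      using assms unfolding mbounded_def mnorm_def by (rule cSup_upper)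
    have "L2_set (\<lambda>i. cmod (\<Sum>j\<in>G. M i j * y j)) F
        = L2_set (\<lambda>i. (1/s) * cmod (\<Sum>j\<in>G. M i j * x j)) F"
      using sp by (intro L2_set_cong)
        (auto simp: y_def norm_divide sum_divide_distrib[symmetric])
    also have "\<dots> = (1/s) * L2_set (\<lambda>i. cmod (\<Sum>j\<in>G. M i j * x j)) F"
      using sp by (intro L2_set_right_distrib[symmetric]) simp
    finally show ?thesis using le sp by (simp add: s_def field_simps)
  qed
qed

lemma mnorm_set_0: "0 \<in> mnorm_set M"
  unfolding mnorm_set_def by (intro CollectI exI[of _ "{}"] exI[of _ "\<lambda>_. 0"]) auto

lemma norm_bound_imp_mnorm_le:
  assumes "norm_bound M C" and "C \<ge> 0"
  shows "mbounded M" and "mnorm M \<le> C"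
proof -
  have *: "y \<le> C" if "y \<in> mnorm_set M" for y
  proof -
    from that obtain F G x where y: "y = L2_set (\<lambda>i. cmod (\<Sum>j\<in>G. M i j * x j)) F"
      and fin: "finite F" "finite G" and x: "(\<Sum>j\<in>G. (cmod (x j))\<^sup>2) \<le> 1"
      unfolding mnorm_set_def L2_set_def by blast
    have "y \<le> C * L2_set (\<lambda>j. cmod (x j)) G"
      using norm_boundD[OF assms(1) fin] y by simp
    also have "\<dots> \<le> C * 1"
      using x assms(2) by (intro mult_left_mono) (auto simp: L2_set_def)
    finally show ?thesis by simp
  qed
  show "mbounded M" unfolding mbounded_def using * by (meson bdd_above.I)
  show "mnorm M \<le> C" unfolding mnorm_def
    using * mnorm_set_0 by (intro cSup_least) auto
qed

lemma mnorm_nonneg: "mbounded M \<Longrightarrow> 0 \<le> mnorm M"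
  unfolding mbounded_def mnorm_def by (rule cSup_upper[OF mnorm_set_0])

lemma norm_bound_mono:
  assumes "norm_bound M C" "C \<le> C'" shows "norm_bound M C'"
  unfolding norm_bound_def
  using order_trans[OF norm_boundD[OF assms(1)] mult_right_mono[OF assms(2) L2_set_nonneg]]
  by blast

lemma norm_bound_entry:
  assumes "norm_bound M C" shows "cmod (M i j) \<le> C"
  using norm_boundD[OF assms, of "{i}" "{j}" "\<lambda>_. 1"] by (simp add: L2_set_def)

lemma norm_bound_nonneg: "norm_bound M C \<Longrightarrow> 0 \<le> C"
  by (rule order_trans[OF norm_ge_zero norm_bound_entry])

lemma mbounded_iff: "mbounded M \<longleftrightarrow> (\<exists>C. norm_bound M C)"
  by (metis mbounded_imp_norm_bound norm_bound_imp_mnorm_le(1) norm_bound_nonneg)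

lemma norm_bound_add:
  assumes "norm_bound M C" "norm_bound N C'"
  shows "norm_bound (\<lambda>i j. M i j + N i j) (C + C')"
  unfolding norm_bound_def
proof (intro allI impI)
  fix F G :: "'a set" and x :: "'a \<Rightarrow> complex"
  assume fin: "finite F" "finite G"
  have "L2_set (\<lambda>i. cmod (\<Sum>j\<in>G. (M i j + N i j) * x j)) F
      \<le> L2_set (\<lambda>i. cmod (\<Sum>j\<in>G. M i j * x j) + cmod (\<Sum>j\<in>G. N i j * x j)) F"
    by (intro L2_set_mono) (auto simp: distrib_right sum.distrib norm_triangle_ineq)
  also have "\<dots> \<le> L2_set (\<lambda>i. cmod (\<Sum>j\<in>G. M i j * x j)) F + L2_set (\<lambda>i. cmod (\<Sum>j\<in>G. N i j * x j)) F"
    by (rule L2_set_triangle_ineq)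
  also have "\<dots> \<le> (C + C') * L2_set (\<lambda>j. cmod (x j)) G"
    using norm_boundD[OF assms(1) fin, of x] norm_boundD[OF assms(2) fin, of x]
    by (simp add: distrib_right)
  finally show "L2_set (\<lambda>i. cmod (\<Sum>j\<in>G. (M i j + N i j) * x j)) F
      \<le> (C + C') * L2_set (\<lambda>j. cmod (x j)) G" .
qed

lemma norm_bound_smul:
  assumes "norm_bound M C"
  shows "norm_bound (smul c M) (cmod c * C)"
  unfolding norm_bound_def
proof (intro allI impI)
  fix F G :: "'a set" and x :: "'a \<Rightarrow> complex"
  assume fin: "finite F" "finite G"
  have "L2_set (\<lambda>i. cmod (\<Sum>j\<in>G. smul c M i j * x j)) F
      = L2_set (\<lambda>i. cmod c * cmod (\<Sum>j\<in>G. M i j * x j)) F"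
    by (simp add: smul_def norm_mult[symmetric] sum_distrib_left mult.assoc)
  also have "\<dots> = cmod c * L2_set (\<lambda>i. cmod (\<Sum>j\<in>G. M i j * x j)) F"
    by (simp add: L2_set_right_distrib)
  also have "\<dots> \<le> cmod c * (C * L2_set (\<lambda>j. cmod (x j)) G)"
    by (intro mult_left_mono norm_boundD assms fin) simp
  finally show "L2_set (\<lambda>i. cmod (\<Sum>j\<in>G. smul c M i j * x j)) F \<le> cmod c * C * L2_set (\<lambda>j. cmod (x j)) G"
    by (simp add: mult.assoc)
qed

lemma norm_bound_zero: "norm_bound (\<lambda>i j. 0) 0"
  by (simp add: norm_bound_def L2_set_def)

lemma norm_bound_sub:
  assumes "norm_bound M C" "norm_bound N C'"
  shows "norm_bound (msub M N) (C + C')"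
  using norm_bound_add[OF assms(1) norm_bound_smul[OF assms(2), of "-1"]]
  by (simp add: msub_def smul_def)

lemma norm_bound_msum:
  assumes "finite S" "\<And>a. a \<in> S \<Longrightarrow> norm_bound (T a) (C a)"
  shows "norm_bound (msum S T) (sum C S)"
  using assms
proof (induction S rule: finite_induct)
  case empty
  then show ?case by (simp add: msum_def norm_bound_zero)
next
  case (insert a S)
  then have "norm_bound (\<lambda>i j. T a i j + msum S T i j) (C a + sum C S)"
    by (intro norm_bound_add) auto
  then show ?case using insert by (simp add: msum_def)
qed

lemma norm_bound_diag:
  assumes "\<And>i j. i \<noteq> j \<Longrightarrow> M i j = 0" "\<And>i. cmod (M i i) \<le> C"
  shows "norm_bound M C"
  unfolding norm_bound_def
proof (intro allI impI)
  fix F G :: "'a set" and x :: "'a \<Rightarrow> complex"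
  assume fin: "finite F" "finite G"
  \<comment> \<open>Any index will do here; every type is inhabited.\<close>
  have C: "C \<ge> 0" using order_trans[OF norm_ge_zero assms(2)[of undefined]] .
  have e: "(\<Sum>j\<in>G. M i j * x j) = (if i \<in> G then M i i * x i else 0)" for i
  proof -
    have "(\<Sum>j\<in>G. M i j * x j) = (\<Sum>j\<in>G. if j = i then M i i * x i else 0)"
      using assms(1) by (intro sum.cong) auto
    then show ?thesis using fin by simp
  qed
  have "L2_set (\<lambda>i. cmod (\<Sum>j\<in>G. M i j * x j)) F \<le> L2_set (\<lambda>i. C * (if i \<in> G then cmod (x i) else 0)) F"
    unfolding e using assms(2) C by (intro L2_set_mono) (auto simp: norm_mult mult_right_mono)
  also have "\<dots> = C * L2_set (\<lambda>i. if i \<in> G then cmod (x i) else 0) F"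
    using C by (simp add: L2_set_right_distrib)
  also have "L2_set (\<lambda>i. if i \<in> G then cmod (x i) else 0) F \<le> L2_set (\<lambda>i. cmod (x i)) G"
    unfolding L2_set_def
  proof (intro real_sqrt_le_mono)
    have "(\<Sum>i\<in>F. (if i \<in> G then cmod (x i) else 0)\<^sup>2) = (\<Sum>i\<in>F \<inter> G. (cmod (x i))\<^sup>2)"
      using fin by (intro sum.mono_neutral_cong_right) auto
    also have "\<dots> \<le> (\<Sum>i\<in>G. (cmod (x i))\<^sup>2)" using fin by (intro sum_mono2) auto
    finally show "(\<Sum>i\<in>F. (if i \<in> G then cmod (x i) else 0)\<^sup>2) \<le> (\<Sum>i\<in>G. (cmod (x i))\<^sup>2)" .
  qed
  finally show "L2_set (\<lambda>i. cmod (\<Sum>j\<in>G. M i j * x j)) F \<le> C * L2_set (\<lambda>j. cmod (x j)) G"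
    using C by (simp add: mult_left_mono)
qed

lemma norm_bound_mid: "norm_bound (mid D) 1"
  by (rule norm_bound_diag) (auto simp: mid_def)

text \<open>A finite section depends continuously on finitely many entries, so entrywise convergence
  of the matrices is enough.\<close>

lemma norm_bound_limit:
  assumes "\<And>n::nat. norm_bound (M n) (C n)"
    and "\<And>i j. (\<lambda>n. M n i j) \<longlonglongrightarrow> N i j" and "C \<longlonglongrightarrow> c"
  shows "norm_bound N c"
  unfolding norm_bound_def
proof (intro allI impI)
  fix F G :: "'a set" and x :: "'a \<Rightarrow> complex"
  assume fin: "finite F" "finite G"
  have "(\<lambda>n. L2_set (\<lambda>i. cmod (\<Sum>j\<in>G. M n i j * x j)) F)
      \<longlonglongrightarrow> L2_set (\<lambda>i. cmod (\<Sum>j\<in>G. N i j * x j)) F"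
    unfolding L2_set_def by (intro tendsto_intros assms)
  moreover have "(\<lambda>n. C n * L2_set (\<lambda>j. cmod (x j)) G) \<longlonglongrightarrow> c * L2_set (\<lambda>j. cmod (x j)) G"
    by (intro tendsto_intros assms)
  ultimately show "L2_set (\<lambda>i. cmod (\<Sum>j\<in>G. N i j * x j)) F \<le> c * L2_set (\<lambda>j. cmod (x j)) G"
    by (rule LIMSEQ_le) (use norm_boundD[OF assms(1) fin] in auto)
qed

lemma norm_bound_bilinear:
  assumes "norm_bound M C" "finite F" "finite G"
  shows "cmod (\<Sum>i\<in>F. \<Sum>j\<in>G. y i * M i j * x j)
    \<le> C * L2_set (\<lambda>i. cmod (y i)) F * L2_set (\<lambda>j. cmod (x j)) G"
proof -
  have "cmod (\<Sum>i\<in>F. \<Sum>j\<in>G. y i * M i j * x j) = cmod (\<Sum>i\<in>F. y i * (\<Sum>j\<in>G. M i j * x j))"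
    by (simp add: sum_distrib_left mult.assoc)
  also have "\<dots> \<le> (\<Sum>i\<in>F. \<bar>cmod (y i)\<bar> * \<bar>cmod (\<Sum>j\<in>G. M i j * x j)\<bar>)"
    by (intro order_trans[OF norm_sum]) (simp add: norm_mult)
  also have "\<dots> \<le> L2_set (\<lambda>i. cmod (y i)) F * L2_set (\<lambda>i. cmod (\<Sum>j\<in>G. M i j * x j)) F"
    by (rule L2_set_mult_ineq)
  also have "\<dots> \<le> L2_set (\<lambda>i. cmod (y i)) F * (C * L2_set (\<lambda>j. cmod (x j)) G)"
    by (intro mult_left_mono norm_boundD assms) simp
  finally show ?thesis by (simp add: algebra_simps)
qed

section \<open>Adjoints and products\<close>

text \<open>Pair y = M^* x with itself: the bilinear bound gives |y|^2 <= C |x| |y|, and |y| cancels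
  unless it is 0.\<close>

lemma norm_bound_madj:
  assumes "norm_bound M C" shows "norm_bound (madj M) C"
  unfolding norm_bound_def
proof (intro allI impI)
  fix F G :: "'a set" and x :: "'a \<Rightarrow> complex"
  assume fin: "finite F" "finite G"
  define y where "y = (\<lambda>i. \<Sum>j\<in>G. madj M i j * x j)"
  let ?L = "L2_set (\<lambda>i. cmod (y i)) F"
  have "(\<Sum>j\<in>G. \<Sum>i\<in>F. cnj (x j) * M j i * y i) = (\<Sum>i\<in>F. \<Sum>j\<in>G. cnj (x j) * M j i * y i)"
    by (rule sum.swap)
  also have "\<dots> = (\<Sum>i\<in>F. cnj (y i) * y i)"
  proof (rule sum.cong[OF refl])
    fix i
    have "cnj (y i) = (\<Sum>j\<in>G. cnj (x j) * M j i)"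
      by (simp add: y_def madj_def mult.commute)
    then show "(\<Sum>j\<in>G. cnj (x j) * M j i * y i) = cnj (y i) * y i"
      by (simp add: sum_distrib_right)
  qed
  also have "\<dots> = of_real (\<Sum>i\<in>F. (cmod (y i))\<^sup>2)"
    by (simp only: of_real_sum complex_norm_square mult.commute)
  finally have "cmod (\<Sum>j\<in>G. \<Sum>i\<in>F. cnj (x j) * M j i * y i) = (\<Sum>i\<in>F. (cmod (y i))\<^sup>2)"
    by (simp only: norm_of_real) (simp add: sum_nonneg)
  also have "\<dots> = ?L\<^sup>2" by (simp add: L2_set_def sum_nonneg)
  finally have "?L\<^sup>2 \<le> C * L2_set (\<lambda>j. cmod (x j)) G * ?L"
    using norm_bound_bilinear[OF assms fin(2,1), of "\<lambda>j. cnj (x j)" y] by simp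
  then have "?L \<le> C * L2_set (\<lambda>j. cmod (x j)) G"
    using norm_bound_nonneg[OF assms]
    by (cases "?L = 0") (auto simp: power2_eq_square less_le)
  then show "L2_set (\<lambda>i. cmod (\<Sum>j\<in>G. madj M i j * x j)) F \<le> C * L2_set (\<lambda>j. cmod (x j)) G"
    by (simp add: y_def)
qed

text \<open>Square-summable columns, and rows via the adjoint, are what makes the infinite sums
  inside \<open>mmul\<close> converge.\<close>

lemma norm_bound_column:
  assumes "norm_bound M C" shows "(\<lambda>i. (cmod (M i j))\<^sup>2) summable_on UNIV"
proof (rule nonneg_bdd_above_summable_on)
  show "bdd_above (sum (\<lambda>i. (cmod (M i j))\<^sup>2) ` {F. F \<subseteq> UNIV \<and> finite F})"
  proof (intro bdd_aboveI[of _ "C\<^sup>2"], clarsimp)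
    fix F :: "'a set" assume F: "finite F"
    have "L2_set (\<lambda>i. cmod (M i j)) F \<le> C"
      using norm_boundD[OF assms F, of "{j}" "\<lambda>_. 1"] by (simp add: L2_set_def)
    then have "(L2_set (\<lambda>i. cmod (M i j)) F)\<^sup>2 \<le> C\<^sup>2" by (intro power_mono) auto
    then show "(\<Sum>i\<in>F. (cmod (M i j))\<^sup>2) \<le> C\<^sup>2" by (simp add: L2_set_def sum_nonneg)
  qed
qed auto

lemma has_sum_finite_sum:
  fixes f :: "'a \<Rightarrow> 'b \<Rightarrow> 'c :: topological_comm_monoid_add"
  assumes "finite G" "\<And>j. j \<in> G \<Longrightarrow> (f j has_sum S j) A"
  shows "((\<lambda>l. \<Sum>j\<in>G. f j l) has_sum (\<Sum>j\<in>G. S j)) A"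
  using assms by (induction G rule: finite_induct) (auto intro!: has_sum_add)

text \<open>An \<open>infsum\<close> is 0 by default when it diverges, so convergence has to be
  secured before products become additive. It follows from |ab| <= |a|^2 + |b|^2.\<close>

lemma norm_bound_mmul_summable:
  assumes "norm_bound A C" "norm_bound B C'"
  shows "(\<lambda>l. A i l * B l j) summable_on UNIV"
proof -
  have "(\<lambda>l. (cmod (A i l))\<^sup>2) summable_on UNIV"
    using norm_bound_column[OF norm_bound_madj[OF assms(1)], of i] by (simp add: madj_def)
  then have "(\<lambda>l. (cmod (A i l))\<^sup>2 + (cmod (B l j))\<^sup>2) summable_on UNIV"
    by (intro summable_on_add norm_bound_column[OF assms(2)])
  then have "(\<lambda>l. norm (A i l * B l j)) summable_on UNIV"
  proof (rule summable_on_comparison_test)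
    fix l
    show "norm (A i l * B l j) \<le> (cmod (A i l))\<^sup>2 + (cmod (B l j))\<^sup>2"
      using sum_squares_bound[of "cmod (A i l)" "cmod (B l j)"]
        mult_nonneg_nonneg[OF norm_ge_zero[of "A i l"] norm_ge_zero[of "B l j"]]
      unfolding norm_mult by linarith
  qed auto
  then show ?thesis by (rule abs_summable_summable)
qed

text \<open>The finite sections of the vector \<open>B x\<close> are bounded by \<open>W\<close>, although \<open>B x\<close> itself
  need not be finitely supported.\<close>
lemma mmul_vector_bound:
  assumes A: "norm_bound A C" and B: "norm_bound B C'" and fin: "finite F" "finite G"
    and W: "\<And>L. finite L \<Longrightarrow> L2_set (\<lambda>l. cmod (\<Sum>j\<in>G. B l j * x j)) L \<le> W"
  shows "L2_set (\<lambda>i. cmod (\<Sum>j\<in>G. mmul A B i j * x j)) F \<le> C * W"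
proof -
  let ?w = "\<lambda>l. \<Sum>j\<in>G. B l j * x j"
  have "((\<lambda>l. A i l * ?w l) has_sum (\<Sum>j\<in>G. mmul A B i j * x j)) UNIV" for i
  proof -
    have "((\<lambda>l. \<Sum>j\<in>G. A i l * B l j * x j) has_sum (\<Sum>j\<in>G. mmul A B i j * x j)) UNIV"
      unfolding mmul_def
      by (intro has_sum_finite_sum fin has_sum_cmult_left has_sum_infsum norm_bound_mmul_summable[OF A B])
    then show ?thesis by (simp add: sum_distrib_left mult.assoc)
  qed
  then have lim: "((\<lambda>L. \<Sum>l\<in>L. A i l * ?w l) \<longlongrightarrow> (\<Sum>j\<in>G. mmul A B i j * x j)) (finite_subsets_at_top UNIV)" for i
    by (simp add: has_sum_def)
  have "((\<lambda>L. L2_set (\<lambda>i. cmod (\<Sum>l\<in>L. A i l * ?w l)) F) \<longlongrightarrow>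
     L2_set (\<lambda>i. cmod (\<Sum>j\<in>G. mmul A B i j * x j)) F) (finite_subsets_at_top UNIV)"
    unfolding L2_set_def by (intro tendsto_intros lim)
  then show ?thesis
  proof (rule tendsto_upperbound)
    show "\<forall>\<^sub>F L in finite_subsets_at_top UNIV. L2_set (\<lambda>i. cmod (\<Sum>l\<in>L. A i l * ?w l)) F \<le> C * W"
    proof (rule eventually_finite_subsets_at_top_weakI)
      fix L :: "'a set" assume L: "finite L"
      have "L2_set (\<lambda>i. cmod (\<Sum>l\<in>L. A i l * ?w l)) F \<le> C * L2_set (\<lambda>l. cmod (?w l)) L"
        by (rule norm_boundD[OF A fin(1) L])
      also have "\<dots> \<le> C * W"
        using norm_bound_nonneg[OF A] W[OF L] by (rule mult_left_mono[rotated])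
      finally show "L2_set (\<lambda>i. cmod (\<Sum>l\<in>L. A i l * ?w l)) F \<le> C * W" .
    qed
  qed simp
qed

lemma norm_bound_mmul:
  assumes "norm_bound A C" "norm_bound B C'"
  shows "norm_bound (mmul A B) (C * C')"
  unfolding norm_bound_def
proof (intro allI impI)
  fix F G :: "'a set" and x :: "'a \<Rightarrow> complex"
  assume fin: "finite F" "finite G"
  show "L2_set (\<lambda>i. cmod (\<Sum>j\<in>G. mmul A B i j * x j)) F \<le> C * C' * L2_set (\<lambda>j. cmod (x j)) G"
    using mmul_vector_bound[OF assms fin norm_boundD[OF assms(2) _ fin(2)]]
    by (simp add: mult.assoc)
qed


lemma infsum_single:
  fixes f :: "'a \<Rightarrow> complex"
  assumes "\<And>l. l \<noteq> g \<Longrightarrow> f l = 0"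
  shows "infsum f UNIV = f g"
proof -
  have "infsum f UNIV = infsum f {g}"
    using assms by (intro infsum_cong_neutral) auto
  then show ?thesis by simp
qed

lemma mmul_smul_left: "mmul (smul c A) B = smul c (mmul A B)"
  by (simp add: mmul_def smul_def fun_eq_iff mult.assoc infsum_cmult_right')

lemma mmul_smul_right: "mmul A (smul c B) = smul c (mmul A B)"
  by (simp add: mmul_def smul_def fun_eq_iff mult.left_commute infsum_cmult_right')

lemma mmul_msub_right:
  assumes "norm_bound A a" "norm_bound B b" "norm_bound B' b'"
  shows "mmul A (msub B B') = msub (mmul A B) (mmul A B')"
proof (intro ext)
  fix i j
  have "infsum (\<lambda>l. A i l * B l j + - (A i l * B' l j)) UNIV
      = infsum (\<lambda>l. A i l * B l j) UNIV + infsum (\<lambda>l. - (A i l * B' l j)) UNIV"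
    using norm_bound_mmul_summable[OF assms(1,2)] norm_bound_mmul_summable[OF assms(1,3)]
    by (intro infsum_add) (auto simp: summable_on_uminus)
  then show "mmul A (msub B B') i j = msub (mmul A B) (mmul A B') i j"
    by (simp add: mmul_def msub_def algebra_simps infsum_uminus)
qed

lemma mmul_msub_left:
  assumes "norm_bound A a" "norm_bound A' a'" "norm_bound B b"
  shows "mmul (msub A A') B = msub (mmul A B) (mmul A' B)"
proof (intro ext)
  fix i j
  have "infsum (\<lambda>l. A i l * B l j + - (A' i l * B l j)) UNIV
      = infsum (\<lambda>l. A i l * B l j) UNIV + infsum (\<lambda>l. - (A' i l * B l j)) UNIV"
    using norm_bound_mmul_summable[OF assms(1,3)] norm_bound_mmul_summable[OF assms(2,3)]
    by (intro infsum_add) (auto simp: summable_on_uminus)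
  then show "mmul (msub A A') B i j = msub (mmul A B) (mmul A' B) i j"
    by (simp add: mmul_def msub_def algebra_simps infsum_uminus)
qed

lemma mmul_mid_right:
  assumes "\<And>i j. j \<notin> D \<Longrightarrow> A i j = 0" shows "mmul A (mid D) = A"
proof (intro ext)
  fix i j show "mmul A (mid D) i j = A i j"
    using infsum_single[of j "\<lambda>l. A i l * mid D l j"] assms[of j i]
    by (auto simp: mmul_def mid_def)
qed

lemma mmul_mid_left:
  assumes "\<And>i j. i \<notin> D \<Longrightarrow> A i j = 0" shows "mmul (mid D) A = A"
proof (intro ext)
  fix i j show "mmul (mid D) A i j = A i j"
    using infsum_single[of i "\<lambda>l. mid D i l * A l j"] assms[of i j]
    by (auto simp: mmul_def mid_def)
qed

lemma mmul_row_zero: "(\<And>l. A i l = 0) \<Longrightarrow> mmul A B i j = 0"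
  by (simp add: mmul_def)

lemma mmul_col_zero: "(\<And>l. B l j = 0) \<Longrightarrow> mmul A B i j = 0"
  by (simp add: mmul_def)

lemma op_on_norm_bound: "op_on D M \<Longrightarrow> \<exists>C. norm_bound M C"
  by (auto simp: op_on_def mbounded_iff)

section \<open>Norm convergence\<close>

lemma mconvI:
  assumes "norm_bound S C" "\<And>N. norm_bound (msub S (P N)) (e N)" "e \<longlonglongrightarrow> 0"
  shows "mconv P S"
  unfolding mconv_def
proof (intro conjI allI)
  show "mbounded S" "mbounded (msub S (P N))" for N
    using assms mbounded_iff by blast+
  have "norm (mnorm (msub S (P N))) \<le> e N" for N
    using norm_bound_imp_mnorm_le[OF assms(2) norm_bound_nonneg[OF assms(2)], of N]
      mnorm_nonneg[of "msub S (P N)"] by simp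
  then show "(\<lambda>N. mnorm (msub S (P N))) \<longlonglongrightarrow> 0"
    by (intro Lim_null_comparison[OF _ assms(3)]) auto
qed

lemma mconvD:
  assumes "mconv P S"
  shows "norm_bound S (mnorm S)" "norm_bound (msub S (P N)) (mnorm (msub S (P N)))"
    "(\<lambda>N. mnorm (msub S (P N))) \<longlonglongrightarrow> 0"
  using assms by (auto simp: mconv_def intro: mbounded_imp_norm_bound)

lemma mconv_entry:
  assumes "mconv P S" shows "(\<lambda>N. P N i j) \<longlonglongrightarrow> S i j"
proof -
  have "(\<lambda>N. P N i j - S i j) \<longlonglongrightarrow> 0"
  proof (rule Lim_null_comparison[OF _ mconvD(3)[OF assms]])
    show "\<forall>\<^sub>F N in sequentially. norm (P N i j - S i j) \<le> mnorm (msub S (P N))"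
      using norm_bound_entry[OF mconvD(2)[OF assms]]
      by (simp add: msub_def norm_minus_commute)
  qed
  then show ?thesis by (simp add: LIM_zero_iff)
qed

text \<open>Ensures that the \<open>THE\<close> in \<open>fh_eval\<close> and \<open>sc_eval\<close>
  picks the actual sum of the series.\<close>

lemma mconv_unique: "mconv P S \<Longrightarrow> mconv P S' \<Longrightarrow> S = S'"
  by (intro ext LIMSEQ_unique[OF mconv_entry mconv_entry])

text \<open>Split A0 B0 - A B as A0 (B0 - B) + (A0 - A) B; the factor B m is bounded by b + e m,
  being within e m of B0. This carries monomials from the polyball to its closure.\<close>

lemma mconv_mmul:
  assumes "mconv A A0" "mconv B B0"
  shows "mconv (\<lambda>m. mmul (A m) (B m)) (mmul A0 B0)"
proof -
  define d e where "d = (\<lambda>m. mnorm (msub A0 (A m)))" and "e = (\<lambda>m. mnorm (msub B0 (B m)))"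
  have bd: "norm_bound (msub A0 (A m)) (d m)" "norm_bound (msub B0 (B m)) (e m)" for m
    using mconvD(2)[OF assms(1)] mconvD(2)[OF assms(2)] by (auto simp: d_def e_def)
  have lim: "d \<longlonglongrightarrow> 0" "e \<longlonglongrightarrow> 0"
    using mconvD(3)[OF assms(1)] mconvD(3)[OF assms(2)] by (auto simp: d_def e_def)
  obtain a b where a: "norm_bound A0 a" and b: "norm_bound B0 b"
    using mconvD(1) assms by blast
  have A: "norm_bound (A m) (a + d m)" for m
    using norm_bound_sub[OF a bd(1)[of m]] by (simp add: msub_def)
  have B: "norm_bound (B m) (b + e m)" for m
    using norm_bound_sub[OF b bd(2)[of m]] by (simp add: msub_def)
  have "norm_bound (msub (mmul A0 B0) (mmul (A m) (B m))) (a * e m + d m * (b + e m))" for m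
  proof -
    have "msub (mmul A0 B0) (mmul (A m) (B m))
      = (\<lambda>i j. mmul A0 (msub B0 (B m)) i j + mmul (msub A0 (A m)) (B m) i j)"
      by (simp add: mmul_msub_right[OF a b B] mmul_msub_left[OF a A B]) (simp add: msub_def)
    then show ?thesis
      by (simp only:) (intro norm_bound_add norm_bound_mmul a bd B)
  qed
  moreover have "(\<lambda>m. a * e m + d m * (b + e m)) \<longlonglongrightarrow> a * 0 + 0 * (b + 0)"
    by (intro tendsto_intros lim)
  ultimately show ?thesis
    by (intro mconvI[OF norm_bound_mmul[OF a b]]) auto
qed

lemma mconv_const: "norm_bound M C \<Longrightarrow> mconv (\<lambda>_. M) M"
  by (rule mconvI[where e = "\<lambda>_. 0"]) (auto simp: msub_def norm_bound_zero)

section \<open>Amplification by commuting coisometries\<close>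

text \<open>The polyball is defined for matrices indexed by \<open>nat\<close> only, so pairs of indices are encoded
  by \<open>prod_encode\<close>.\<close>
definition ten :: "nat mat \<Rightarrow> nat mat \<Rightarrow> nat mat" where
  "ten A V = (\<lambda>x y. A (fst (prod_decode x)) (fst (prod_decode y)) *
     V (snd (prod_decode x)) (snd (prod_decode y)))"

definition lev :: "nat set \<Rightarrow> nat set" where
  "lev D = {x. fst (prod_decode x) \<in> D}"

text \<open>Row m has its single 1 in column m q, so for q > 0 this is the coisometry sending
  \<open>e_(m q)\<close> to \<open>e_m\<close> and killing the other basis vectors. The identity is
  written \<open>shiftm 1\<close>, so that one multiplication law covers every case. Index 0 is
  fixed by all these operators; entries are read off at positive levels only.\<close>

definition shiftm :: "nat \<Rightarrow> nat mat" where
  "shiftm q = (\<lambda>m m'. if m' = m * q then 1 else 0)"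

text \<open>A row of V has at most one nonzero entry, so the sum over encoded pairs collapses to a
  sum over first components, and no infinite sums have to be interchanged.\<close>

lemma mmul_ten:
  assumes "\<And>m. \<exists>g. \<forall>l. l \<noteq> g \<longrightarrow> V m l = 0"
  shows "mmul (ten A V) (ten B W) = ten (mmul A B) (mmul V W)"
proof (intro ext)
  fix x y
  obtain h m where x: "prod_decode x = (h, m)" by fastforce
  obtain h' m' where y: "prod_decode y = (h', m')" by fastforce
  obtain g where g: "\<And>l. l \<noteq> g \<Longrightarrow> V m l = 0" using assms by blast
  define f where "f = (\<lambda>z. ten A V x z * ten B W z y)"
  let ?e = "\<lambda>l. prod_encode (l, g)"
  have inj: "inj ?e" by (auto intro: injI)
  have 0: "f z = 0" if "z \<notin> range ?e" for z
  proof -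
    have "snd (prod_decode z) \<noteq> g"
      using that by (metis prod.collapse prod_decode_inverse rangeI)
    then show ?thesis using g by (simp add: f_def ten_def x)
  qed
  have "mmul (ten A V) (ten B W) x y = infsum f UNIV" by (simp add: mmul_def f_def)
  also have "\<dots> = infsum f (range ?e)"
    using 0 by (intro infsum_cong_neutral) auto
  also have "\<dots> = infsum (\<lambda>l. f (?e l)) UNIV"
    using infsum_reindex[OF inj, of f] by (simp add: o_def)
  also have "\<dots> = infsum (\<lambda>l. A h l * B l h' * (V m g * W g m')) UNIV"
    by (simp add: f_def ten_def x y mult_ac)
  also have "\<dots> = mmul A B h h' * (V m g * W g m')"
    by (simp add: infsum_cmult_left' mmul_def)
  also have "V m g * W g m' = mmul V W m m'"
    using infsum_single[of g "\<lambda>l. V m l * W l m'"] g by (simp add: mmul_def)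
  finally show "mmul (ten A V) (ten B W) x y = ten (mmul A B) (mmul V W) x y"
    by (simp add: ten_def x y)
qed

lemma shiftm_row: "\<exists>g. \<forall>l. l \<noteq> g \<longrightarrow> shiftm q m l = 0"
  by (rule exI[of _ "m * q"]) (simp add: shiftm_def)

lemma mmul_shiftm: "mmul (shiftm q) W m m' = W (m * q) m'"
  using infsum_single[of "m * q" "\<lambda>l. shiftm q m l * W l m'"]
  by (simp add: mmul_def shiftm_def)

lemma shiftm_mult: "mmul (shiftm q) (shiftm q') = shiftm (q * q')"
  by (simp add: fun_eq_iff mmul_shiftm) (simp add: shiftm_def mult.assoc)

lemma shiftm_coisometry: "q > 0 \<Longrightarrow> mmul (shiftm q) (madj (shiftm q)) = shiftm 1"
  by (auto simp: fun_eq_iff mmul_shiftm) (auto simp: shiftm_def madj_def)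

lemma madj_ten: "madj (ten A V) = ten (madj A) (madj V)"
  by (simp add: madj_def ten_def)

lemma msum_ten: "msum S (\<lambda>a. ten (T a) V) = ten (msum S T) V"
  by (simp add: msum_def ten_def sum_distrib_right)

lemma msub_ten: "msub (ten A V) (ten B V) = ten (msub A B) V"
  by (simp add: msub_def ten_def left_diff_distrib)

lemma mid_lev: "mid (lev D) = ten (mid D) (shiftm 1)"
proof (intro ext)
  fix x y
  have "x = y \<longleftrightarrow> prod_decode x = prod_decode y" by simp
  then show "mid (lev D) x y = ten (mid D) (shiftm 1) x y"
    by (auto simp: mid_def lev_def ten_def shiftm_def prod_eq_iff)
qed

text \<open>Output level m depends only on input level m q, and distinct m use distinct input levels
  since q > 0. The squared estimates for A on the single levels therefore add up.\<close>

lemma norm_bound_ten: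
  assumes A: "norm_bound A C" and q: "q > 0"
  shows "norm_bound (ten A (shiftm q)) C"
  unfolding norm_bound_def
proof (intro allI impI)
  fix F G :: "nat set" and x :: "nat \<Rightarrow> complex"
  assume fin: "finite F" "finite G"
  \<comment> \<open>Padding x by zero lets every level be summed over the same set
    \<open>G1\<close>.\<close>
  define z where "z = (\<lambda>y. if y \<in> G then x y else 0)"
  define H G1 M where "H = fst ` prod_decode ` F" and "G1 = fst ` prod_decode ` G"
    and "M = snd ` prod_decode ` F"
  have fin': "finite H" "finite G1" "finite M" using fin by (auto simp: H_def G1_def M_def)
  have C: "C \<ge> 0" by (rule norm_bound_nonneg[OF A])
  define w where "w = (\<lambda>h m. \<Sum>h'\<in>G1. A h h' * z (prod_encode (h', m * q)))"
  have row: "(\<Sum>j\<in>G. ten A (shiftm q) i j * x j) = w (fst (prod_decode i)) (snd (prod_decode i))" for i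
  proof -
    let ?m = "snd (prod_decode i) * q"
    have "(\<Sum>j\<in>G. ten A (shiftm q) i j * x j)
        = (\<Sum>j\<in>(\<lambda>h'. prod_encode (h', ?m)) ` G1. ten A (shiftm q) i j * z j)"
    proof (rule sum.mono_neutral_cong)
      show "finite G" "finite ((\<lambda>h'. prod_encode (h', ?m)) ` G1)" using fin fin' by auto
    next
      fix j assume j: "j \<in> G - (\<lambda>h'. prod_encode (h', ?m)) ` G1"
      then have "snd (prod_decode j) \<noteq> ?m"
        by (metis DiffD1 DiffD2 G1_def image_eqI prod.collapse prod_decode_inverse)
      then show "ten A (shiftm q) i j * x j = 0" by (simp add: ten_def shiftm_def)
    qed (auto simp: z_def)
    also have "\<dots> = w (fst (prod_decode i)) (snd (prod_decode i))"
      by (subst sum.reindex) (auto simp: inj_on_def w_def ten_def shiftm_def)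
    finally show ?thesis .
  qed
  have "(\<Sum>i\<in>F. (cmod (\<Sum>j\<in>G. ten A (shiftm q) i j * x j))\<^sup>2)
      = (\<Sum>(h, m)\<in>prod_decode ` F. (cmod (w h m))\<^sup>2)"
    unfolding row by (subst sum.reindex) (auto simp: case_prod_beta inj_prod_decode intro: inj_on_subset)
  also have "\<dots> \<le> (\<Sum>(h, m)\<in>H \<times> M. (cmod (w h m))\<^sup>2)"
  proof (rule sum_mono2)
    show "prod_decode ` F \<subseteq> H \<times> M"
      unfolding H_def M_def by (rule subset_fst_snd)
  qed (use fin' in auto)
  also have "\<dots> = (\<Sum>m\<in>M. \<Sum>h\<in>H. (cmod (w h m))\<^sup>2)"
    by (subst sum.swap) (simp add: sum.cartesian_product)
  also have "\<dots> \<le> (\<Sum>m\<in>M. C\<^sup>2 * (\<Sum>h'\<in>G1. (cmod (z (prod_encode (h', m * q))))\<^sup>2))"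
  proof (rule sum_mono)
    fix m
    have "(L2_set (\<lambda>h. cmod (w h m)) H)\<^sup>2 \<le> (C * L2_set (\<lambda>h'. cmod (z (prod_encode (h', m * q)))) G1)\<^sup>2"
      using norm_boundD[OF A fin'(1,2)] by (intro power_mono) (auto simp: w_def)
    then show "(\<Sum>h\<in>H. (cmod (w h m))\<^sup>2) \<le> C\<^sup>2 * (\<Sum>h'\<in>G1. (cmod (z (prod_encode (h', m * q))))\<^sup>2)"
      by (simp add: L2_set_def power_mult_distrib sum_nonneg)
  qed
  also have "\<dots> = C\<^sup>2 * (\<Sum>(m, h')\<in>M \<times> G1. (cmod (z (prod_encode (h', m * q))))\<^sup>2)"
    by (simp add: sum_distrib_left sum.cartesian_product case_prod_beta)
  also have "(\<Sum>(m, h')\<in>M \<times> G1. (cmod (z (prod_encode (h', m * q))))\<^sup>2)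
      = (\<Sum>y\<in>(\<lambda>(m, h'). prod_encode (h', m * q)) ` (M \<times> G1). (cmod (z y))\<^sup>2)"
    using q by (subst sum.reindex) (auto simp: inj_on_def case_prod_beta)
  also have "\<dots> \<le> (\<Sum>y\<in>G. (cmod (x y))\<^sup>2)"
  proof -
    let ?S = "(\<lambda>(m, h'). prod_encode (h', m * q)) ` (M \<times> G1)"
    have "(\<Sum>y\<in>?S. (cmod (z y))\<^sup>2) = (\<Sum>y\<in>?S \<inter> G. (cmod (x y))\<^sup>2)"
      using fin' by (intro sum.mono_neutral_cong_right) (auto simp: z_def)
    also have "\<dots> \<le> (\<Sum>y\<in>G. (cmod (x y))\<^sup>2)" using fin by (intro sum_mono2) auto
    finally show ?thesis .
  qed
  finally have "(\<Sum>i\<in>F. (cmod (\<Sum>j\<in>G. ten A (shiftm q) i j * x j))\<^sup>2) \<le> C\<^sup>2 * (\<Sum>y\<in>G. (cmod (x y))\<^sup>2)"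
    by (simp add: mult_left_mono)
  then have "L2_set (\<lambda>i. cmod (\<Sum>j\<in>G. ten A (shiftm q) i j * x j)) F
      \<le> sqrt (C\<^sup>2 * (\<Sum>y\<in>G. (cmod (x y))\<^sup>2))"
    unfolding L2_set_def by (rule real_sqrt_le_mono)
  then show "L2_set (\<lambda>i. cmod (\<Sum>j\<in>G. ten A (shiftm q) i j * x j)) F \<le> C * L2_set (\<lambda>j. cmod (x j)) G"
    using C by (simp add: L2_set_def real_sqrt_mult)
qed

lemma op_on_ten: "op_on D M \<Longrightarrow> q > 0 \<Longrightarrow> op_on (lev D) (ten M (shiftm q))"
  using norm_bound_ten by (auto simp: op_on_def mbounded_iff ten_def lev_def)

section \<open>The amplified point of the polyball\<close>

definition blowup :: "(nat \<Rightarrow> nat) \<Rightarrow> (nat \<Rightarrow> nat \<Rightarrow> nat mat) \<Rightarrow> nat \<Rightarrow> nat \<Rightarrow> nat mat" where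
  "blowup P X = (\<lambda>i j. ten (X i j) (shiftm (P i)))"

text \<open>The place where coisometry enters: the second factor becomes V V^* = I, so
  \<open>Phi\<close> acts on the first factor alone.\<close>

lemma Phi_blowup:
  assumes "P i > 0"
  shows "Phi (blowup P X i) N (ten Z (shiftm 1)) = ten (Phi (X i) N Z) (shiftm 1)"
  using assms
  by (simp add: Phi_def blowup_def madj_ten mmul_ten shiftm_row shiftm_mult shiftm_coisometry
      msum_ten del: One_nat_def)

lemma Delta_blowup:
  assumes "\<forall>i<k. P i > 0"
  shows "Delta k n (blowup P X) (ten Z (shiftm 1)) = ten (Delta k n X Z) (shiftm 1)"
proof -
  have "foldr (\<lambda>i Z. msub Z (Phi (blowup P X i) (n i) Z)) is (ten Z (shiftm 1))
      = ten (foldr (\<lambda>i Z. msub Z (Phi (X i) (n i) Z)) is Z) (shiftm 1)" if "\<forall>i\<in>set is. P i > 0" for "is"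
    using that by (induction "is") (auto simp: Phi_blowup msub_ten simp del: One_nat_def)
  then show ?thesis using assms by (simp add: Delta_def)
qed

text \<open>Sorted by second component, x splits into slices z m, and the quadratic form of T tensor
  I at x is the sum over m of the form of T at z m.\<close>

lemma mpos_ten:
  assumes "mpos D T" shows "mpos (lev D) (ten T (shiftm 1))"
  unfolding mpos_def Let_def
proof (intro allI impI)
  fix G :: "nat set" and x :: "nat \<Rightarrow> complex" assume G: "finite G \<and> G \<subseteq> lev D"
  define M G1 where "M = snd ` prod_decode ` G" and "G1 = fst ` prod_decode ` G"
  have fin: "finite M" "finite G1" using G by (auto simp: M_def G1_def)
  have G1: "G1 \<subseteq> D" using G by (auto simp: G1_def lev_def)
  define z where "z = (\<lambda>m h. if prod_encode (h, m) \<in> G then x (prod_encode (h, m)) else 0)"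
  define q where "q = (\<lambda>m. \<Sum>i\<in>G1. \<Sum>j\<in>G1. cnj (z m i) * T i j * z m j)"
  have conv: "(\<Sum>i\<in>G. f i) = (\<Sum>m\<in>M. \<Sum>h\<in>G1. if prod_encode (h, m) \<in> G then f (prod_encode (h, m)) else 0)"
    for f :: "nat \<Rightarrow> complex"
  proof -
    have "(\<Sum>m\<in>M. \<Sum>h\<in>G1. if prod_encode (h, m) \<in> G then f (prod_encode (h, m)) else 0)
      = (\<Sum>p\<in>M \<times> G1. if prod_encode (snd p, fst p) \<in> G then f (prod_encode (snd p, fst p)) else 0)"
      by (simp add: sum.cartesian_product case_prod_beta)
    also have "\<dots> = (\<Sum>p\<in>{p\<in>M \<times> G1. prod_encode (snd p, fst p) \<in> G}. f (prod_encode (snd p, fst p)))"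
      using fin by (intro sum.inter_filter[symmetric]) auto
    also have "\<dots> = (\<Sum>i\<in>G. f i)"
      by (rule sum.reindex_bij_witness[where
          i = "\<lambda>i. (snd (prod_decode i), fst (prod_decode i))" and
          j = "\<lambda>p. prod_encode (snd p, fst p)"]) (auto simp: M_def G1_def)
    finally show ?thesis by simp
  qed
  have "(\<Sum>i\<in>G. \<Sum>j\<in>G. cnj (x i) * ten T (shiftm 1) i j * x j)
    = (\<Sum>m\<in>M. \<Sum>h\<in>G1. \<Sum>m'\<in>M. \<Sum>h'\<in>G1. if m' = m then cnj (z m h) * T h h' * z m h' else 0)"
    unfolding conv
    by (intro sum.cong refl) (auto simp: z_def ten_def shiftm_def intro!: sum.cong sum.neutral)
  also have "\<dots> = (\<Sum>m\<in>M. q m)"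
    unfolding q_def
  proof (intro sum.cong[OF refl])
    fix m h assume m: "m \<in> M"
    have "(\<Sum>m'\<in>M. \<Sum>h'\<in>G1. if m' = m then cnj (z m h) * T h h' * z m h' else 0)
      = (\<Sum>m'\<in>M. if m' = m then \<Sum>h'\<in>G1. cnj (z m h) * T h h' * z m h' else 0)"
      by (intro sum.cong) auto
    then show "(\<Sum>m'\<in>M. \<Sum>h'\<in>G1. if m' = m then cnj (z m h) * T h h' * z m h' else 0)
      = (\<Sum>h'\<in>G1. cnj (z m h) * T h h' * z m h')" using m fin by simp
  qed
  finally have eq: "(\<Sum>i\<in>G. \<Sum>j\<in>G. cnj (x i) * ten T (shiftm 1) i j * x j) = (\<Sum>m\<in>M. q m)" .
  have "Im (q m) = 0 \<and> Re (q m) \<ge> 0" for m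
    using assms fin G1 unfolding mpos_def Let_def q_def by blast
  then show "Im (\<Sum>i\<in>G. \<Sum>j\<in>G. cnj (x i) * ten T (shiftm 1) i j * x j) = 0 \<and>
      Re (\<Sum>i\<in>G. \<Sum>j\<in>G. cnj (x i) * ten T (shiftm 1) i j * x j) \<ge> 0"
    unfolding eq by (auto intro: sum_nonneg)
qed

lemma minvertible_ten:
  assumes "minvertible D T" shows "minvertible (lev D) (ten T (shiftm 1))"
proof -
  obtain S where S: "op_on D S" "mmul T S = mid D" "mmul S T = mid D"
    using assms by (auto simp: minvertible_def)
  show ?thesis unfolding minvertible_def
    by (rule exI[of _ "ten S (shiftm 1)"])
      (simp add: op_on_ten mmul_ten shiftm_row shiftm_mult S mid_lev del: One_nat_def)
qed

lemma polyball_blowup: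
  assumes X: "polyball k n D X" and P: "\<forall>i<k. P i > 0"
  shows "polyball k n (lev D) (blowup P X)"
  unfolding polyball_def
proof (intro conjI allI impI)
  fix i j assume i: "i < k" "j < n i"
  show "op_on (lev D) (blowup P X i j)"
    using X P i by (auto simp: blowup_def polyball_def intro: op_on_ten)
next
  fix s t a b assume "s < k" "t < k" "s \<noteq> t" "a < n s" "b < n t"
  then have "mmul (X s a) (X t b) = mmul (X t b) (X s a)" using X by (simp add: polyball_def)
  then show "mmul (blowup P X s a) (blowup P X t b) = mmul (blowup P X t b) (blowup P X s a)"
    by (simp add: blowup_def mmul_ten shiftm_row shiftm_mult mult.commute)
next
  fix i assume i: "i < k"
  let ?S = "msum {..<n i} (\<lambda>j. mmul (X i j) (madj (X i j)))"
  \<comment> \<open>The value of \<open>mnorm\<close> is informative only for bounded matrices.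
    Boundedness of \<open>?S\<close> is derived from its finitely many factors first; the size of
    the constants does not matter.\<close>
  have "\<forall>j<n i. \<exists>C. norm_bound (X i j) C"
    using X i op_on_norm_bound unfolding polyball_def by blast
  then obtain C where "\<And>j. j < n i \<Longrightarrow> norm_bound (X i j) (C j)" by metis
  then have "norm_bound ?S (\<Sum>j<n i. C j * C j)"
    by (intro norm_bound_msum norm_bound_mmul norm_bound_madj) auto
  then have b: "norm_bound ?S (mnorm ?S)"
    by (intro mbounded_imp_norm_bound) (auto simp: mbounded_iff)
  have "msum {..<n i} (\<lambda>j. mmul (blowup P X i j) (madj (blowup P X i j))) = ten ?S (shiftm 1)"
    using P i by (simp add: blowup_def madj_ten mmul_ten shiftm_row shiftm_coisometry msum_ten
        del: One_nat_def)
  moreover have "mnorm (ten ?S (shiftm 1)) \<le> mnorm ?S"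
    using norm_bound_ten[OF b, of 1] norm_bound_nonneg[OF b]
    by (intro norm_bound_imp_mnorm_le) auto
  ultimately show "mnorm (msum {..<n i} (\<lambda>j. mmul (blowup P X i j) (madj (blowup P X i j)))) < 1"
    using X i by (auto simp: polyball_def)
next
  show "mpos (lev D) (Delta k n (blowup P X) (mid (lev D)))"
    "minvertible (lev D) (Delta k n (blowup P X) (mid (lev D)))"
    using X P by (auto simp: mid_lev Delta_blowup polyball_def mpos_ten minvertible_ten
        simp del: One_nat_def)
qed


section \<open>Monomials\<close>

lemma wprod_Nil [simp]: "wprod D Xi [] = mid D"
  by (simp add: wprod_def)

lemma wprod_Cons [simp]: "wprod D Xi (j # ws) = mmul (Xi j) (wprod D Xi ws)"
  by (simp add: wprod_def)

lemma op_on_mid: "op_on D (mid D)"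
  using norm_bound_mid by (auto simp: op_on_def mbounded_iff mid_def)

lemma op_on_mmul:
  assumes "op_on D A" "op_on D B" shows "op_on D (mmul A B)"
proof -
  obtain a b where "norm_bound A a" "norm_bound B b"
    using assms op_on_norm_bound by blast
  then have "mbounded (mmul A B)" using norm_bound_mmul mbounded_iff by blast
  then show ?thesis using assms by (auto simp: op_on_def intro: mmul_row_zero mmul_col_zero)
qed

lemma op_on_wprod:
  assumes "\<forall>j<N. op_on D (Xi j)" "\<forall>c\<in>set ws. c < N"
  shows "op_on D (wprod D Xi ws)"
  using assms(2) by (induction ws) (auto simp: op_on_mid op_on_mmul assms(1))

lemma op_on_mono:
  assumes "\<forall>i<k. \<forall>j<n i. op_on D (X i j)" "tup k n \<alpha>"
  shows "op_on D (mono k D X \<alpha>)"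
proof -
  have "op_on D (foldr (\<lambda>i M. mmul (wprod D (X i) (\<alpha> i)) M) is (mid D))" if "\<forall>i\<in>set is. i < k" for "is"
    using that
  proof (induction "is")
    case (Cons i "is")
    then have "op_on D (wprod D (X i) (\<alpha> i))"
      using assms by (intro op_on_wprod[where N = "n i"]) (auto simp: tup_def)
    then show ?case using Cons by (simp add: op_on_mmul)
  qed (simp add: op_on_mid)
  then show ?thesis by (simp add: mono_def)
qed

lemma mconv_wprod:
  assumes "\<forall>j<N. mconv (\<lambda>m. Y m j) (Xi j)" "\<forall>c\<in>set ws. c < N"
  shows "mconv (\<lambda>m. wprod D (Y m) ws) (wprod D Xi ws)"
  using assms(2)
  by (induction ws) (auto intro!: mconv_mmul mconv_const[OF norm_bound_mid] simp: assms(1))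

lemma mconv_mono:
  assumes "\<forall>i<k. \<forall>j<n i. mconv (\<lambda>m. Y m i j) (X i j)" "tup k n \<alpha>"
  shows "mconv (\<lambda>m. mono k D (Y m) \<alpha>) (mono k D X \<alpha>)"
proof -
  have "mconv (\<lambda>m. foldr (\<lambda>i M. mmul (wprod D (Y m i) (\<alpha> i)) M) is (mid D))
      (foldr (\<lambda>i M. mmul (wprod D (X i) (\<alpha> i)) M) is (mid D))" if "\<forall>i\<in>set is. i < k" for "is"
    using that
  proof (induction "is")
    case Nil
    then show ?case by (simp add: mconv_const[OF norm_bound_mid])
  next
    case (Cons i "is")
    then have "mconv (\<lambda>m. wprod D (Y m i) (\<alpha> i)) (wprod D (X i) (\<alpha> i))"
      using assms by (intro mconv_wprod[where N = "n i"]) (auto simp: tup_def)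
    then show ?case using Cons by (simp add: mconv_mmul)
  qed
  then show ?thesis by (simp add: mono_def)
qed

lemma smul_smul: "smul a (smul b M) = smul (a * b) M"
  by (simp add: smul_def mult.assoc)

lemma smul_one: "smul 1 M = M"
  by (simp add: smul_def)

lemma wprod_smul:
  assumes "\<forall>j<N. Xi j = smul c (Yi j)" "\<forall>c\<in>set ws. c < N"
  shows "wprod D Xi ws = smul (c ^ length ws) (wprod D Yi ws)"
  using assms(2)
  by (induction ws) (auto simp: assms(1) mmul_smul_left mmul_smul_right smul_smul smul_one mult.commute)

lemma mono_smul:
  assumes "\<forall>i<k. \<forall>j<n i. X i j = smul (c i) (Y i j)" "tup k n \<alpha>"
  shows "mono k D X \<alpha> = smul (\<Prod>i<k. c i ^ length (\<alpha> i)) (mono k D Y \<alpha>)"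
proof -
  have "foldr (\<lambda>i M. mmul (wprod D (X i) (\<alpha> i)) M) is (mid D)
      = smul (prod_list (map (\<lambda>i. c i ^ length (\<alpha> i)) is))
         (foldr (\<lambda>i M. mmul (wprod D (Y i) (\<alpha> i)) M) is (mid D))" if "\<forall>i\<in>set is. i < k" for "is"
    using that
  proof (induction "is")
    case (Cons i "is")
    then have "wprod D (X i) (\<alpha> i) = smul (c i ^ length (\<alpha> i)) (wprod D (Y i) (\<alpha> i))"
      using assms by (intro wprod_smul[where N = "n i"]) (auto simp: tup_def)
    then show ?case using Cons by (simp add: mmul_smul_left mmul_smul_right smul_smul mult.commute)
  qed (simp add: smul_one)
  from this[of "[0..<k]"] show ?thesis
    by (simp add: mono_def prod.distinct_set_conv_list[symmetric] atLeast0LessThan)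
qed

section \<open>Prime weights of multidegrees\<close>

text \<open>Since the shifts multiply, a monomial of multidegree p in the amplified point carries
  one shift, by this factor.\<close>

definition weight :: "nat \<Rightarrow> (nat \<Rightarrow> nat) \<Rightarrow> (nat \<Rightarrow> nat) \<Rightarrow> nat" where
  "weight k P p = (\<Prod>i<k. P i ^ p i)"

lemma wprod_blowup:
  "wprod (lev D) (blowup P X i) ws = ten (wprod D (X i) ws) (shiftm (P i ^ length ws))"
  by (induction ws)
    (auto simp: mid_lev blowup_def mmul_ten shiftm_row shiftm_mult simp del: One_nat_def)

lemma mono_blowup:
  "mono k (lev D) (blowup P X) \<alpha> = ten (mono k D X \<alpha>) (shiftm (weight k P (\<lambda>i. length (\<alpha> i))))"
proof -
  have "foldr (\<lambda>i M. mmul (wprod (lev D) (blowup P X i) (\<alpha> i)) M) is (mid (lev D))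
      = ten (foldr (\<lambda>i M. mmul (wprod D (X i) (\<alpha> i)) M) is (mid D))
          (shiftm (prod_list (map (\<lambda>i. P i ^ length (\<alpha> i)) is)))" for "is"
    by (induction "is")
      (auto simp: mid_lev wprod_blowup mmul_ten shiftm_row shiftm_mult simp del: One_nat_def)
  from this[of "[0..<k]"] show ?thesis
    by (simp add: mono_def weight_def prod.distinct_set_conv_list[symmetric] atLeast0LessThan)
qed

lemma mono_g0: "mono k D X g0 = mid D"
proof -
  have mm: "mmul (mid D) (mid D) = mid D" by (rule mmul_mid_left) (simp add: mid_def)
  have "foldr (\<lambda>i M. mmul (wprod D (X i) (g0 i)) M) is (mid D) = mid D" for "is"
    by (induction "is") (auto simp: g0_def mm)
  then show ?thesis by (simp add: mono_def)
qed

text \<open>The exponent p i is recovered as the multiplicity of the prime P i in the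
  weight.\<close>

lemma weight_inj:
  assumes "\<And>i. prime (P i)" "inj P" "weight k P p = weight k P q" "i < k"
  shows "p i = q i"
proof -
  have "multiplicity (P i) (weight k P p) = p i" for p
  proof -
    have nz: "P j \<noteq> 0" for j using assms(1)[of j] by auto
    have "multiplicity (P i) (weight k P p) = (\<Sum>j<k. multiplicity (P i) (P j ^ p j))"
      unfolding weight_def
    proof (rule prime_elem_multiplicity_prod_distrib)
      show "0 \<notin> (\<lambda>j. P j ^ p j) ` {..<k}" 
      proof
        assume "0 \<in> (\<lambda>j. P j ^ p j) ` {..<k}"
        then show False
        proof (rule imageE)
          fix j assume "0 = P j ^ p j"
          then show False using nz[of j] by simp
        qed
      qed
    qed (use assms(1) in \<open>auto intro: prime_imp_prime_elem\<close>)
    also have "\<dots> = (\<Sum>j<k. if j = i then p i else 0)"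
    proof (intro sum.cong refl)
      fix j
      show "multiplicity (P i) (P j ^ p j) = (if j = i then p i else 0)"
        using assms(1,2) by (auto simp: multiplicity_prime_power multiplicity_distinct_prime_power inj_eq)
    qed
    finally show ?thesis using assms(4) by simp
  qed
  from this[of p] this[of q] show ?thesis using assms(3) by simp
qed

lemma weight_pos: "(\<And>i. prime (P i)) \<Longrightarrow> weight k P p > 0"
  unfolding weight_def by (intro prod_pos) (auto simp: prime_gt_0_nat)

lemma weight_0: "weight k P (\<lambda>_. 0) = 1"
  by (simp add: weight_def)

lemma prime_sequence: "\<exists>P :: nat \<Rightarrow> nat. (\<forall>i. prime (P i)) \<and> inj P"
proof (intro exI conjI allI)
  show "prime (enumerate {p::nat. prime p} i)" for i
    using enumerate_in_set[OF primes_infinite, of i] by simp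
  show "inj (enumerate {p::nat. prime p})"
    using strict_mono_enumerate[OF primes_infinite] strict_mono_imp_inj_on by blast
qed

lemma finite_DegSet: "finite (DegSet k n q)"
proof (rule finite_subset)
  \<comment> \<open>A crude bound valid for all k alphabets at once.\<close>
  let ?N = "\<Sum>i<k. n i"
  let ?L = "{ws. set ws \<subseteq> {..<?N} \<and> length ws \<le> q}"
  show "DegSet k n q \<subseteq> {f. \<forall>i. (i \<in> {..<k} \<longrightarrow> f i \<in> ?L) \<and> (i \<notin> {..<k} \<longrightarrow> f i = [])}"
  proof
    fix \<alpha> assume \<alpha>: "\<alpha> \<in> DegSet k n q"
    have "\<alpha> i \<in> ?L" if i: "i < k" for i
    proof -
      have "length (\<alpha> i) \<le> (\<Sum>i<k. length (\<alpha> i))" "n i \<le> ?N"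
        using i by (auto intro!: member_le_sum[of i "{..<k}"])
      moreover have "\<forall>c\<in>set (\<alpha> i). c < n i" using \<alpha> i by (simp add: DegSet_def tup_def)
      ultimately show ?thesis using \<alpha> by (force simp: DegSet_def)
    qed
    then show "\<alpha> \<in> {f. \<forall>i. (i \<in> {..<k} \<longrightarrow> f i \<in> ?L) \<and> (i \<notin> {..<k} \<longrightarrow> f i = [])}"
      using \<alpha> by (auto simp: DegSet_def tup_def)
  qed
  show "finite {f. \<forall>i. (i \<in> {..<k} \<longrightarrow> f i \<in> ?L) \<and> (i \<notin> {..<k} \<longrightarrow> f i = [])}"
    by (intro finite_set_of_finite_funs finite_lists_length_le) auto
qed

lemma Lam_eq: "Lam k n p = {\<alpha>\<in>DegSet k n (\<Sum>i<k. p i). \<forall>i<k. length (\<alpha> i) = p i}"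
  by (auto simp: Lam_def DegSet_def)

lemma finite_Lam: "finite (Lam k n p)"
  by (simp add: Lam_eq finite_DegSet)

lemma Lam_0: "Lam k n (\<lambda>_. 0) = {g0}"
  by (auto simp: Lam_def g0_def tup_def fun_eq_iff) (metis not_le)

text \<open>The \<open>2 \<times> 2\<close> operator matrix with rows \<open>(a0, B)\<close> and \<open>(0, a0)\<close> is applied to
  the vector \<open>(t w, u)\<close> with \<open>w = B u\<close>; the value of \<open>t\<close> is optimal.\<close>
lemma corner_norm_bound:
  fixes e0 e1 :: "'x \<Rightarrow> 'y"
  assumes S: "norm_bound S M" and inj: "inj e0" "inj e1" and disj: "\<And>x y. e0 x \<noteq> e1 y"
    and S00: "\<And>x y. S (e0 x) (e0 y) = (if x = y \<and> x \<in> E then a0 else 0)"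
    and S11: "\<And>x y. S (e1 x) (e1 y) = (if x = y \<and> x \<in> E then a0 else 0)"
    and S01: "\<And>x y. S (e0 x) (e1 y) = B x y" and S10: "\<And>x y. S (e1 x) (e0 y) = 0"
    and supp: "\<And>x y. x \<notin> E \<or> y \<notin> E \<Longrightarrow> B x y = 0" and a0: "cmod a0 \<le> M"
  shows "norm_bound B ((M\<^sup>2 - (cmod a0)\<^sup>2) / M)"
  unfolding norm_bound_def
proof (intro allI impI)
  fix F G :: "'x set" and u :: "'x \<Rightarrow> complex"
  assume fin0: "finite F" "finite G"
  \<comment> \<open>The diagonal blocks are a0 only on E, and B vanishes off E, so it suffices to
    test there.\<close>
  define F' G' where "F' = F \<inter> E" and "G' = G \<inter> E"
  have fin: "finite F'" "finite G'" using fin0 by (auto simp: F'_def G'_def)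
  have M0: "M \<ge> 0" by (rule norm_bound_nonneg[OF S])
  define w where "w = (\<lambda>i. \<Sum>j\<in>G. B i j * u j)"
  have w: "w i = (\<Sum>j\<in>G'. B i j * u j)" for i
    unfolding w_def using fin0 supp by (intro sum.mono_neutral_right) (auto simp: G'_def)
  define W U where "W = (\<Sum>i\<in>F'. (cmod (w i))\<^sup>2)" and "U = (\<Sum>j\<in>G'. (cmod (u j))\<^sup>2)"
  have W0: "W \<ge> 0" and U0: "U \<ge> 0" by (auto simp: W_def U_def sum_nonneg)
  have key: "(cmod (1 + a0 * t))\<^sup>2 * W + (cmod a0)\<^sup>2 * U \<le> M\<^sup>2 * (U + (cmod t)\<^sup>2 * W)" for t
  proof -
    define z where "z = (\<lambda>y. if y \<in> range e0 then t * w (inv e0 y) else u (inv e1 y))"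
    have "e1 i \<notin> range e0" for i
      using disj by (metis imageE)
    then have z: "z (e0 i) = t * w i" "z (e1 i) = u i" for i
      using inj by (simp_all add: z_def)
    let ?R = "e0 ` F' \<union> e1 ` G'"
    have split: "(\<Sum>y\<in>?R. f y) = (\<Sum>i\<in>F'. f (e0 i)) + (\<Sum>j\<in>G'. f (e1 j))"
      for f :: "'y \<Rightarrow> 'z :: comm_monoid_add"
    proof -
      have "(\<Sum>y\<in>?R. f y) = (\<Sum>y\<in>e0 ` F'. f y) + (\<Sum>y\<in>e1 ` G'. f y)"
        using fin disj by (intro sum.union_disjoint) auto
      then show ?thesis
        using inj by (simp add: sum.reindex inj_on_subset[OF inj(1)] inj_on_subset[OF inj(2)])
    qed
    have r0: "(\<Sum>c\<in>?R. S (e0 i) c * z c) = (1 + a0 * t) * w i" if "i \<in> F'" for i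
    proof -
      have "(\<Sum>i'\<in>F'. S (e0 i) (e0 i') * z (e0 i')) = (\<Sum>i'\<in>F'. if i' = i then a0 * t * w i else 0)"
        using that by (intro sum.cong) (auto simp: S00 z F'_def)
      then show ?thesis using that fin by (simp add: split S01 z w algebra_simps)
    qed
    have r1: "(\<Sum>c\<in>?R. S (e1 j) c * z c) = a0 * u j" if "j \<in> G'" for j
    proof -
      have "(\<Sum>j'\<in>G'. S (e1 j) (e1 j') * z (e1 j')) = (\<Sum>j'\<in>G'. if j' = j then a0 * u j else 0)"
        using that by (intro sum.cong) (auto simp: S11 z G'_def)
      then show ?thesis using that fin by (simp add: split S10)
    qed
    have "(L2_set (\<lambda>y. cmod (\<Sum>c\<in>?R. S y c * z c)) ?R)\<^sup>2 \<le> (M * L2_set (\<lambda>c. cmod (z c)) ?R)\<^sup>2"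
      using fin by (intro power_mono norm_boundD[OF S]) auto
    then have "(\<Sum>y\<in>?R. (cmod (\<Sum>c\<in>?R. S y c * z c))\<^sup>2) \<le> M\<^sup>2 * (\<Sum>c\<in>?R. (cmod (z c))\<^sup>2)"
      by (simp add: L2_set_def power_mult_distrib sum_nonneg)
    moreover have "(\<Sum>y\<in>?R. (cmod (\<Sum>c\<in>?R. S y c * z c))\<^sup>2) = (cmod (1 + a0 * t))\<^sup>2 * W + (cmod a0)\<^sup>2 * U"
      unfolding split[of "\<lambda>y. (cmod (\<Sum>c\<in>?R. S y c * z c))\<^sup>2"]
      by (simp add: r0 r1 W_def U_def norm_mult power_mult_distrib sum_distrib_left)
    moreover have "(\<Sum>c\<in>?R. (cmod (z c))\<^sup>2) = U + (cmod t)\<^sup>2 * W"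
      by (simp add: split z W_def U_def norm_mult power_mult_distrib sum_distrib_left)
    ultimately show ?thesis by simp
  qed
  define s where "s = M\<^sup>2 - (cmod a0)\<^sup>2"
  have s0: "s \<ge> 0" using a0 by (simp add: s_def power_mono)
  have WU: "W \<le> (s / M)\<^sup>2 * U"
  proof (cases "s = 0")
    \<comment> \<open>If |a0| = M, then t = 0 already forces W <= 0. This case includes M =
      0.\<close>
    case True
    then show ?thesis using key[of 0] by (simp add: s_def)
  next
    case False
    then have sp: "s > 0" using s0 by simp
    then have Mp: "M > 0" using M0 by (cases "M = 0") (auto simp: s_def)
    \<comment> \<open>The maximiser of |1 + a0 t|^2 - M^2 |t|^2, with maximum M^2 / s. With it
      \<open>key\<close> reads (M^2 / s) W <= s U.\<close>
    define t where "t = cnj a0 / of_real s"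
    have "a0 * t = of_real ((cmod a0)\<^sup>2 / s)"
      unfolding of_real_divide complex_norm_square by (simp add: t_def)
    then have "1 + a0 * t = of_real (1 + (cmod a0)\<^sup>2 / s)" by simp
    then have 1: "(cmod (1 + a0 * t))\<^sup>2 = (1 + (cmod a0)\<^sup>2 / s)\<^sup>2"
      by (simp only: norm_of_real) simp
    have "1 + (cmod a0)\<^sup>2 / s = M\<^sup>2 / s" using sp by (simp add: field_simps s_def)
    then have 2: "(cmod (1 + a0 * t))\<^sup>2 = M\<^sup>2 * (M\<^sup>2 / s\<^sup>2)"
      unfolding 1 by (simp add: power2_eq_square)
    have "M\<^sup>2 - s = (cmod a0)\<^sup>2" by (simp add: s_def)
    then have 3: "(cmod t)\<^sup>2 = (M\<^sup>2 - s) / s\<^sup>2"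
      using sp by (simp add: t_def norm_divide power_divide)
    have "M\<^sup>2 * (M\<^sup>2 / s\<^sup>2) * W + (M\<^sup>2 - s) * U \<le> M\<^sup>2 * (U + (M\<^sup>2 - s) / s\<^sup>2 * W)"
      using key[of t] unfolding 2 3 by (simp add: s_def)
    then have "M\<^sup>2 * (M\<^sup>2 / s\<^sup>2) * W - M\<^sup>2 * ((M\<^sup>2 - s) / s\<^sup>2 * W) \<le> s * U"
      by (simp add: algebra_simps)
    also have "M\<^sup>2 * (M\<^sup>2 / s\<^sup>2) * W - M\<^sup>2 * ((M\<^sup>2 - s) / s\<^sup>2 * W) = M\<^sup>2 / s * W"
      using sp by (simp add: field_simps power2_eq_square)
    finally have "M\<^sup>2 * W \<le> s\<^sup>2 * U" using sp by (simp add: field_simps power2_eq_square)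
    then show ?thesis using Mp by (simp add: power_divide field_simps)
  qed
  have "(\<Sum>i\<in>F. (cmod (w i))\<^sup>2) = W"
    unfolding W_def w_def using fin0 supp by (intro sum.mono_neutral_right) (auto simp: F'_def)
  then have "L2_set (\<lambda>i. cmod (\<Sum>j\<in>G. B i j * u j)) F = sqrt W"
    by (simp add: L2_set_def w_def)
  also have "\<dots> \<le> sqrt ((s / M)\<^sup>2 * (\<Sum>j\<in>G. (cmod (u j))\<^sup>2))"
  proof (rule real_sqrt_le_mono)
    have "U \<le> (\<Sum>j\<in>G. (cmod (u j))\<^sup>2)"
      unfolding U_def using fin0 by (intro sum_mono2) (auto simp: G'_def)
    then show "W \<le> (s / M)\<^sup>2 * (\<Sum>j\<in>G. (cmod (u j))\<^sup>2)"
      using WU by (meson mult_left_mono order_trans zero_le_power2)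
  qed
  also have "\<dots> = s / M * L2_set (\<lambda>j. cmod (u j)) G"
    using s0 M0 by (simp add: real_sqrt_mult L2_set_def)
  finally show "L2_set (\<lambda>i. cmod (\<Sum>j\<in>G. B i j * u j)) F
      \<le> (M\<^sup>2 - (cmod a0)\<^sup>2) / M * L2_set (\<lambda>j. cmod (u j)) G"
    by (simp add: s_def)
qed


section \<open>Homogeneous parts and the majorant series\<close>

text \<open>The finite set B lies in a box {0..N}^k, over which the sum factors into k truncated
  geometric series.\<close>

lemma sum_monomials_le:
  fixes r :: "nat \<Rightarrow> real"
  assumes r: "\<forall>i<k. 0 \<le> r i \<and> r i < 1" and B: "finite B" "B \<subseteq> Mindex k"
  shows "(\<Sum>p\<in>B. \<Prod>i<k. r i ^ p i) \<le> (\<Prod>i<k. 1 / (1 - r i))"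
proof -
  define N where "N = (\<Sum>p\<in>B. \<Sum>i<k. p i)"
  have N: "p i \<le> N" if "p \<in> B" "i < k" for p i
  proof -
    have "p i \<le> (\<Sum>i<k. p i)" using that by (intro member_le_sum) auto
    also have "\<dots> \<le> N" unfolding N_def using that B by (intro member_le_sum) auto
    finally show ?thesis .
  qed
  \<comment> \<open>Multi-indices are 0 from k on, while members of \<open>PiE\<close> are
    \<open>undefined\<close> there; restriction translates between the two, injectively on
    B.\<close>
  let ?R = "\<lambda>p. restrict p {..<k}"
  have inj: "inj_on ?R B"
  proof (rule inj_onI)
    fix p q assume pq: "p \<in> B" "q \<in> B" "?R p = ?R q"
    show "p = q"
    proof
      fix i show "p i = q i"
      proof (cases "i < k")
        case True
        then show ?thesis using fun_cong[OF pq(3), of i] by simp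
      next
        case False
        then have "p i = 0" "q i = 0" using pq B unfolding Mindex_def by auto
        then show ?thesis by simp
      qed
    qed
  qed
  have "(\<Sum>p\<in>B. \<Prod>i<k. r i ^ p i) = (\<Sum>g\<in>?R ` B. \<Prod>i<k. r i ^ g i)"
    by (subst sum.reindex[OF inj]) simp
  also have "\<dots> \<le> (\<Sum>g\<in>PiE {..<k} (\<lambda>_. {..N}). \<Prod>i<k. r i ^ g i)"
  proof (rule sum_mono2)
    show "?R ` B \<subseteq> PiE {..<k} (\<lambda>_. {..N})"
      using N by (intro image_subsetI) (simp only: restrict_PiE_iff, simp)
  qed (use r in \<open>auto intro!: finite_PiE prod_nonneg\<close>)
  also have "\<dots> = (\<Prod>i<k. \<Sum>m\<le>N. r i ^ m)"
    by (rule prod_sum_PiE[symmetric]) auto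
  also have "\<dots> \<le> (\<Prod>i<k. 1 / (1 - r i))"
  proof (intro prod_mono conjI)
    fix i assume "i \<in> {..<k}"
    then have ri: "0 \<le> r i" "r i < 1" using r by auto
    show "0 \<le> (\<Sum>m\<le>N. r i ^ m)" using ri by (simp add: sum_nonneg)
    have "(1 - r i) * (\<Sum>m\<le>N. r i ^ m) \<le> 1" using ri by (simp add: sum_gp_basic)
    then show "(\<Sum>m\<le>N. r i ^ m) \<le> 1 / (1 - r i)" using ri by (simp add: field_simps)
  qed
  finally show ?thesis .
qed

text \<open>The index sets of \<open>K \<otimes> H\<close> (operator coefficients) and of \<open>H\<close> (scalar coefficients)
  are treated together: \<open>kp\<close> and \<open>et\<close> give the \<open>K\<close>- and the \<open>H\<close>-component of an index, and
  \<open>lift m\<close> embeds the \<open>m\<close>-th copy of \<open>H\<close> into \<open>H \<otimes> l2\<close>.\<close>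
locale coefficient_frame =
  fixes kp et :: "'x \<Rightarrow> nat" and lift :: "nat \<Rightarrow> 'x \<Rightarrow> 'x"
  assumes kp_lift: "kp (lift m x) = kp x"
    and et_lift: "et (lift m x) = prod_encode (et x, m)"
    and frame_inj: "kp x = kp y \<Longrightarrow> et x = et y \<Longrightarrow> x = y"
begin

text \<open>Specialises to \<open>fh_term\<close>, and to \<open>sc_term\<close> when each
  coefficient is a scalar operator on a one-dimensional K.\<close>

definition gterm :: "((nat \<Rightarrow> nat list) \<Rightarrow> nat mat) \<Rightarrow> nat \<Rightarrow> nat set \<Rightarrow> (nat \<Rightarrow> nat \<Rightarrow> nat mat)
    \<Rightarrow> (nat \<Rightarrow> nat list) \<Rightarrow> 'x mat" where
  "gterm A k D X \<alpha> = (\<lambda>x y. A \<alpha> (kp x) (kp y) * mono k D X \<alpha> (et x) (et y))"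

definition bounded_series :: "nat \<Rightarrow> (nat \<Rightarrow> nat) \<Rightarrow> ((nat \<Rightarrow> nat list) \<Rightarrow> nat mat) \<Rightarrow> real \<Rightarrow> bool" where
  "bounded_series k n A M \<longleftrightarrow> (\<forall>D X. polyball k n D X \<longrightarrow>
     (\<exists>S. mconv (psums k n (gterm A k D X)) S \<and> norm_bound S M))"

lemma lift_eq_iff: "lift m x = lift m' y \<longleftrightarrow> m = m' \<and> x = y"
proof
  assume *: "lift m x = lift m' y"
  then have "kp x = kp y" by (metis kp_lift)
  moreover have "(et x, m) = (et y, m')" using * by (metis et_lift prod_encode_inverse)
  ultimately show "m = m' \<and> x = y" using frame_inj by simp
qed auto

lemma gterm_blowup:
  "gterm A k (lev D) (blowup P Y) \<alpha> (lift m x) (lift m' y)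
    = (if m' = m * weight k P (\<lambda>i. length (\<alpha> i)) then gterm A k D Y \<alpha> x y else 0)"
  by (simp add: gterm_def kp_lift et_lift mono_blowup ten_def shiftm_def)

text \<open>Between levels m and m times the weight of p, only monomials of multidegree p
  contribute. They all have total degree \<open>?d\<close>, so this entry of the partial sums is
  constant beyond \<open>?d\<close>. Cancelling m requires m > 0.\<close>

lemma limit_blowup_entry:
  assumes S: "mconv (psums k n (gterm A k (lev D) (blowup P Y))) S"
    and P: "\<And>i. prime (P i)" "inj P" and m: "m > 0"
  shows "S (lift m x) (lift (m * weight k P p) y) = msum (Lam k n p) (gterm A k D Y) x y"
proof -
  let ?d = "\<Sum>i<k. p i"
  let ?s = "msum (Lam k n p) (gterm A k D Y) x y"
  have len: "m * weight k P p = m * weight k P (\<lambda>i. length (\<alpha> i)) \<longleftrightarrow> (\<forall>i<k. length (\<alpha> i) = p i)" for \<alpha>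
  proof
    assume "m * weight k P p = m * weight k P (\<lambda>i. length (\<alpha> i))"
    then show "\<forall>i<k. length (\<alpha> i) = p i"
      using weight_inj[OF P, of k p "\<lambda>i. length (\<alpha> i)"] m by simp
  qed (simp add: weight_def)
  have q: "(\<Sum>\<alpha>\<in>DegSet k n q. gterm A k (lev D) (blowup P Y) \<alpha> (lift m x) (lift (m * weight k P p) y))
      = (if q = ?d then ?s else 0)" for q
  proof (cases "q = ?d")
    case True
    have "(\<Sum>\<alpha>\<in>DegSet k n ?d. if \<forall>i<k. length (\<alpha> i) = p i then gterm A k D Y \<alpha> x y else 0) = ?s"
      unfolding msum_def Lam_eq by (rule sum.inter_filter[OF finite_DegSet, symmetric])
    then show ?thesis unfolding gterm_blowup len using True by simp
  next
    case False
    then show ?thesis unfolding gterm_blowup len by (auto simp: DegSet_def intro!: sum.neutral)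
  qed
  have "psums k n (gterm A k (lev D) (blowup P Y)) N (lift m x) (lift (m * weight k P p) y) = ?s"
    if "N > ?d" for N
    using that by (simp add: psums_def msum_def[of "{..<N}"] msum_def[of "DegSet k n _"] q)
  then have "\<forall>\<^sub>F N in sequentially.
      psums k n (gterm A k (lev D) (blowup P Y)) N (lift m x) (lift (m * weight k P p) y) = ?s"
    using eventually_gt_at_top[of ?d] by (rule eventually_mono[rotated])
  then have "(\<lambda>N. psums k n (gterm A k (lev D) (blowup P Y)) N (lift m x) (lift (m * weight k P p) y)) \<longlonglongrightarrow> ?s"
    by (rule tendsto_eventually)
  then show ?thesis using mconv_entry[OF S] LIMSEQ_unique by blast
qed

lemma limit_blowup_entry_0:
  assumes S: "mconv (psums k n (gterm A k (lev D) (blowup P Y))) S"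
    and "\<And>p. m' \<noteq> m * weight k P p"
  shows "S (lift m x) (lift m' y) = 0"
proof -
  have "psums k n (gterm A k (lev D) (blowup P Y)) N (lift m x) (lift m' y) = 0" for N
    using assms(2) by (simp add: psums_def msum_def gterm_blowup)
  then show ?thesis using mconv_entry[OF S, of "lift m x" "lift m' y"] LIMSEQ_unique[OF _ tendsto_const] by simp
qed

text \<open>Hypotheses shared by (i), where M = 1, and by the lower bound for the Bohr radius, where
  M is the norm of F and K is one-dimensional.\<close>

context
  fixes k :: nat and n :: "nat \<Rightarrow> nat" and A :: "(nat \<Rightarrow> nat list) \<Rightarrow> nat mat" and M :: real
    and DK :: "nat set" and a0 :: complex
  assumes bounded: "bounded_series k n A M"
    and supp: "\<And>\<alpha> u v. u \<notin> DK \<or> v \<notin> DK \<Longrightarrow> A \<alpha> u v = 0"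
    and A0: "A g0 = smul a0 (mid DK)"
begin

lemma constant_term:
  "msum (Lam k n (\<lambda>_. 0)) (gterm A k D Y) x y = (if x = y \<and> x \<in> {x. kp x \<in> DK \<and> et x \<in> D} then a0 else 0)"
  using frame_inj by (auto simp: Lam_0 msum_def gterm_def A0 mono_g0 smul_def mid_def)

text \<open>At level 1 a diagonal entry of the amplified sum is a0 itself, and no entry exceeds the
  norm. One-dimensional H suffices for this.\<close>

lemma cmod_constant_le:
  assumes "polyball k n {0} Y" "kp x \<in> DK" "et x = 0"
  shows "cmod a0 \<le> M"
proof -
  obtain P :: "nat \<Rightarrow> nat" where P: "\<And>i. prime (P i)" "inj P" using prime_sequence by blast
  have "polyball k n (lev {0}) (blowup P Y)"
    using P by (intro polyball_blowup assms) (auto simp: prime_gt_0_nat)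
  then obtain S where S: "mconv (psums k n (gterm A k (lev {0}) (blowup P Y))) S" "norm_bound S M"
    using bounded unfolding bounded_series_def by blast
  have "S (lift 1 x) (lift (1 * weight k P (\<lambda>_. 0)) x) = a0"
    using limit_blowup_entry[OF S(1) P, of 1 x "\<lambda>_. 0" x] assms by (simp add: constant_term)
  then show ?thesis using norm_bound_entry[OF S(2)] by metis
qed

text \<open>A nonzero p gives W > 1. Hence levels 1 and W are disjoint, and 1 is not a multiple of
  W, which makes the lower left corner vanish.\<close>

lemma homogeneous_bound_polyball:
  assumes Y: "polyball k n D Y" and a0: "cmod a0 \<le> M" and p: "i < k" "p i \<noteq> 0"
  shows "norm_bound (msum (Lam k n p) (gterm A k D Y)) ((M\<^sup>2 - (cmod a0)\<^sup>2) / M)"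
proof -
  obtain P :: "nat \<Rightarrow> nat" where P: "\<And>i. prime (P i)" "inj P" using prime_sequence by blast
  have "polyball k n (lev D) (blowup P Y)"
    using P by (intro polyball_blowup Y) (auto simp: prime_gt_0_nat)
  then obtain S where S: "mconv (psums k n (gterm A k (lev D) (blowup P Y))) S" "norm_bound S M"
    using bounded unfolding bounded_series_def by blast
  define W where "W = weight k P p"
  have W0: "W > 0" unfolding W_def by (rule weight_pos[OF P(1)])
  have W1: "W \<noteq> 1"
    using weight_inj[OF P, of k p "\<lambda>_. 0" i] p by (auto simp: W_def weight_0)
  have no: "1 \<noteq> W * q" for q
    using W1 by (metis nat_mult_eq_1_iff)
  define E where "E = {x. kp x \<in> DK \<and> et x \<in> D}"
  show ?thesis
  proof (rule corner_norm_bound[where ?e0.0 = "lift 1" and ?e1.0 = "lift W" and E = E, OF S(2)])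
    show "inj (lift 1)" "inj (lift W)" by (auto intro!: injI simp: lift_eq_iff)
    show "lift 1 x \<noteq> lift W y" for x y using W1 by (simp add: lift_eq_iff)
    show "S (lift 1 x) (lift 1 y) = (if x = y \<and> x \<in> E then a0 else 0)" for x y
      using limit_blowup_entry[OF S(1) P, of 1 x "\<lambda>_. 0" y]
      by (simp add: weight_0 constant_term E_def)
    show "S (lift W x) (lift W y) = (if x = y \<and> x \<in> E then a0 else 0)" for x y
      using limit_blowup_entry[OF S(1) P W0, of x "\<lambda>_. 0" y]
      by (simp add: weight_0 constant_term E_def)
    show "S (lift 1 x) (lift W y) = msum (Lam k n p) (gterm A k D Y) x y" for x y
      using limit_blowup_entry[OF S(1) P, of 1 x p y] by (simp add: W_def)
    show "S (lift W x) (lift 1 y) = 0" for x y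
      using no by (intro limit_blowup_entry_0[OF S(1)])
    show "msum (Lam k n p) (gterm A k D Y) x y = 0" if "x \<notin> E \<or> y \<notin> E" for x y
    proof -
      have "gterm A k D Y \<alpha> x y = 0" if "\<alpha> \<in> Lam k n p" for \<alpha>
      proof -
        have "op_on D (mono k D Y \<alpha>)"
          using Y that by (intro op_on_mono[where n = n]) (auto simp: polyball_def Lam_def)
        then show ?thesis
          using \<open>x \<notin> E \<or> y \<notin> E\<close> supp by (auto simp: gterm_def E_def op_on_def)
      qed
      then show ?thesis by (simp add: msum_def)
    qed
  qed (rule a0)
qed

text \<open>A homogeneous part involves finitely many monomials, each norm continuous in the point,
  so its entries converge along a sequence from the polyball and the bound survives.\<close>

lemma homogeneous_bound_closure:
  assumes X: "polyball_cl k n D X" and a0: "cmod a0 \<le> M" and p: "i < k" "p i \<noteq> 0"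
  shows "norm_bound (msum (Lam k n p) (gterm A k D X)) ((M\<^sup>2 - (cmod a0)\<^sup>2) / M)"
proof -
  have "\<exists>Y. polyball k n D Y \<and> (\<forall>i<k. \<forall>j<n i. mnorm (msub (X i j) (Y i j)) < 1 / real (Suc m))" for m
    using X unfolding polyball_cl_def by (metis of_nat_0_less_iff zero_less_Suc zero_less_divide_1_iff)
  then obtain Y where Y: "\<And>m. polyball k n D (Y m)"
    and near: "\<And>m i j. i < k \<Longrightarrow> j < n i \<Longrightarrow> mnorm (msub (X i j) (Y m i j)) < 1 / real (Suc m)"
    by metis
  have conv: "\<forall>i<k. \<forall>j<n i. mconv (\<lambda>m. Y m i j) (X i j)"
  proof (intro allI impI)
    fix i j assume ij: "i < k" "j < n i"
    have "op_on D (X i j)" using X ij by (simp add: polyball_cl_def)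
    then obtain c where c: "norm_bound (X i j) c" using op_on_norm_bound by blast
    show "mconv (\<lambda>m. Y m i j) (X i j)"
    proof (rule mconvI[OF c])
      fix m
      have "op_on D (Y m i j)" using Y[of m] ij by (simp add: polyball_def)
      then obtain c' where c': "norm_bound (Y m i j) c'" using op_on_norm_bound by blast
      have "mbounded (msub (X i j) (Y m i j))"
        using norm_bound_sub[OF c c'] mbounded_iff by blast
      then have "norm_bound (msub (X i j) (Y m i j)) (mnorm (msub (X i j) (Y m i j)))"
        by (rule mbounded_imp_norm_bound)
      then show "norm_bound (msub (X i j) (Y m i j)) (1 / real (Suc m))"
        using near[OF ij, of m] by (rule norm_bound_mono[OF _ less_imp_le])
      show "(\<lambda>m. 1 / real (Suc m)) \<longlonglongrightarrow> 0" by (rule lim_1_over_n[THEN LIMSEQ_Suc])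
    qed
  qed
  show ?thesis
  proof (rule norm_bound_limit)
    show "norm_bound (msum (Lam k n p) (gterm A k D (Y m))) ((M\<^sup>2 - (cmod a0)\<^sup>2) / M)" for m
      by (rule homogeneous_bound_polyball[OF Y a0, where p = p and i = i, OF p])
    show "(\<lambda>m. msum (Lam k n p) (gterm A k D (Y m)) x y) \<longlonglongrightarrow> msum (Lam k n p) (gterm A k D X) x y" for x y
    proof -
      have "(\<lambda>m. mono k D (Y m) \<alpha> u v) \<longlonglongrightarrow> mono k D X \<alpha> u v" if "\<alpha> \<in> Lam k n p" for \<alpha> u v
        using that by (intro mconv_entry[OF mconv_mono[OF conv]]) (simp add: Lam_def)
      then show ?thesis
        unfolding msum_def gterm_def by (intro tendsto_sum tendsto_mult_left)
    qed
  qed auto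
qed

text \<open>Scaling multiplies the part of multidegree p by the monomial of the radii. The constant
  part costs |a0|; the others cost \<open>?C\<close> times a sum of monomials without the term
  1.\<close>

lemma majorant_series_bound:
  assumes X: "scaled_cl k n (\<lambda>i j. r i) D X" and a0: "cmod a0 \<le> M"
    and r: "\<forall>i<k. 0 \<le> r i \<and> r i < 1"
  defines "h \<equiv> \<lambda>p. mnorm (msum (Lam k n p) (gterm A k D X))"
  shows "h summable_on Mindex k"
    and "infsum h (Mindex k) \<le> cmod a0 + (M\<^sup>2 - (cmod a0)\<^sup>2) / M * ((\<Prod>i<k. 1 / (1 - r i)) - 1)"
proof -
  let ?C = "(M\<^sup>2 - (cmod a0)\<^sup>2) / M" and ?m = "\<lambda>p. \<Prod>i<k. r i ^ p i"
  have C: "?C \<ge> 0" using a0 order_trans[OF norm_ge_zero a0] by (simp add: power_mono)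
  obtain Y where Y: "polyball_cl k n D Y"
    and XY: "\<forall>i<k. \<forall>j<n i. X i j = smul (complex_of_real (r i)) (Y i j)"
    using X unfolding scaled_cl_def by blast
  have eq: "msum (Lam k n p) (gterm A k D X)
      = smul (complex_of_real (?m p)) (msum (Lam k n p) (gterm A k D Y))" for p
  proof (intro ext)
    fix x y
    have "gterm A k D X \<alpha> x y = complex_of_real (?m p) * gterm A k D Y \<alpha> x y" if "\<alpha> \<in> Lam k n p" for \<alpha>
    proof -
      have "tup k n \<alpha>" and len: "\<And>i. i < k \<Longrightarrow> length (\<alpha> i) = p i" using that by (auto simp: Lam_def)
      then have "mono k D X \<alpha> = smul (complex_of_real (?m p)) (mono k D Y \<alpha>)"
        using mono_smul[OF XY, of \<alpha> D] by simp
      then show ?thesis by (simp add: gterm_def smul_def)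
    qed
    then show "msum (Lam k n p) (gterm A k D X) x y
        = smul (complex_of_real (?m p)) (msum (Lam k n p) (gterm A k D Y)) x y"
      by (simp add: msum_def smul_def sum_distrib_left)
  qed
  have m0: "?m p \<ge> 0" for p using r by (intro prod_nonneg) auto
  have h: "0 \<le> h p" "h p \<le> ?m p * ?C" if p: "i < k" "p i \<noteq> 0" for p i
  proof -
    have *: "norm_bound (msum (Lam k n p) (gterm A k D X)) (?m p * ?C)"
      using norm_bound_smul[OF homogeneous_bound_closure[OF Y a0, where p = p and i = i, OF p], of "complex_of_real (?m p)"] m0[of p]
      by (simp only: eq norm_of_real abs_of_nonneg)
    show "0 \<le> h p" "h p \<le> ?m p * ?C"
      unfolding h_def using norm_bound_imp_mnorm_le[OF * norm_bound_nonneg[OF *]] mnorm_nonneg by auto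
  qed
  have h0: "0 \<le> h (\<lambda>_. 0)" "h (\<lambda>_. 0) \<le> cmod a0"
  proof -
    have *: "norm_bound (msum (Lam k n (\<lambda>_. 0)) (gterm A k D X)) (cmod a0)"
      by (rule norm_bound_diag) (auto simp: constant_term)
    show "0 \<le> h (\<lambda>_. 0)" "h (\<lambda>_. 0) \<le> cmod a0"
      unfolding h_def using norm_bound_imp_mnorm_le[OF * norm_bound_nonneg[OF *]] mnorm_nonneg by auto
  qed
  have nz: "\<exists>i<k. p i \<noteq> 0" if p: "p \<in> Mindex k" "p \<noteq> (\<lambda>_. 0)" for p
  proof -
    obtain i where "p i \<noteq> 0" using p(2) by auto
    then show ?thesis using p(1) unfolding Mindex_def by (metis (mono_tags) mem_Collect_eq not_le)
  qed
  have hpos: "0 \<le> h p" if "p \<in> Mindex k" for p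
    using h(1) h0(1) nz[OF that] by (cases "p = (\<lambda>_. 0)") auto
  have fin: "sum h B \<le> cmod a0 + ?C * ((\<Prod>i<k. 1 / (1 - r i)) - 1)"
    if B: "finite B" "B \<subseteq> Mindex k" for B
  proof -
    let ?Z = "{\<lambda>_. 0 :: nat}"
    have Z: "(\<lambda>_. 0) \<in> Mindex k" by (simp add: Mindex_def)
    \<comment> \<open>Whether or not B contains the zero multi-index, adding it and splitting it off
      makes the later - 1 remove exactly its monomial.\<close>
    have "sum h B \<le> sum h (insert (\<lambda>_. 0) (B - ?Z))"
      using B hpos Z by (intro sum_mono2) auto
    also have "\<dots> = h (\<lambda>_. 0) + sum h (B - ?Z)" using B by (subst sum.insert) auto
    also have "\<dots> \<le> cmod a0 + (\<Sum>p\<in>B - ?Z. ?m p * ?C)"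
      using h0(2) h(2) nz B by (intro add_mono sum_mono) blast+
    also have "(\<Sum>p\<in>B - ?Z. ?m p * ?C) = ?C * ((\<Sum>p\<in>insert (\<lambda>_. 0) (B - ?Z). ?m p) - 1)"
      using B by (subst sum.insert) (auto simp: sum_distrib_left mult.commute)
    also have "\<dots> \<le> ?C * ((\<Prod>i<k. 1 / (1 - r i)) - 1)"
      using sum_monomials_le[OF r, of "insert (\<lambda>_. 0) (B - ?Z)"] B Z C
      by (intro mult_left_mono) auto
    finally show ?thesis by simp
  qed
  show "h summable_on Mindex k"
    using fin hpos by (intro nonneg_bdd_above_summable_on bdd_aboveI2[where M = "cmod a0 + ?C * ((\<Prod>i<k. 1 / (1 - r i)) - 1)"]) auto
  then show "infsum h (Mindex k) \<le> cmod a0 + ?C * ((\<Prod>i<k. 1 / (1 - r i)) - 1)"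
    using fin by (intro infsum_le_finite_sums) auto
qed

end

end


section \<open>The upper bound\<close>

lemma mmul_smul_mid: "mmul (smul a (mid D)) (smul b (mid D)) = smul (a * b) (mid D)"
proof -
  have "mmul (mid D) (mid D) = mid D" by (rule mmul_mid_left) (simp add: mid_def)
  then show ?thesis by (simp add: mmul_smul_left mmul_smul_right smul_smul mult.commute)
qed

lemma madj_smul_mid: "madj (smul a (mid D)) = smul (cnj a) (mid D)"
  by (auto simp: madj_def smul_def mid_def fun_eq_iff)

lemma norm_bound_smul_mid: "norm_bound (smul c (mid D)) (cmod c)"
  using norm_bound_smul[OF norm_bound_mid] by simp

lemma op_on_smul_mid: "op_on D (smul c (mid D))"
  using norm_bound_smul_mid[of c D] by (auto simp: op_on_def mbounded_iff) (auto simp: smul_def mid_def)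

lemma mnorm_smul_mid:
  assumes "d \<in> D" shows "mnorm (smul c (mid D)) = cmod c"
proof (rule antisym)
  note b = norm_bound_smul_mid[of c D]
  show "mnorm (smul c (mid D)) \<le> cmod c"
    using norm_bound_imp_mnorm_le[OF b] by simp
  have "norm_bound (smul c (mid D)) (mnorm (smul c (mid D)))"
    using norm_bound_imp_mnorm_le[OF b] mbounded_imp_norm_bound by simp
  then show "cmod c \<le> mnorm (smul c (mid D))"
    using norm_bound_entry[of "smul c (mid D)" _ d d] assms by (simp add: smul_def mid_def)
qed

text \<open>Such points play two roles: t = 0 shows that the polyball is nonempty, and t = r is
  where the Bohr sum of a test function becomes a numerical series.\<close>

definition point :: "real \<Rightarrow> nat \<Rightarrow> nat \<Rightarrow> nat mat" where
  "point t i j = smul (if i = 0 \<and> j = 0 then complex_of_real t else 0) (mid {0})"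

text \<open>On scalars \<open>Phi\<close> is multiplication by c i < 1, so \<open>Delta\<close> is
  the product of the positive numbers 1 - c i.\<close>

lemma polyball_point:
  assumes t: "0 \<le> t" "t < 1"
  shows "polyball k n {0} (point t)"
proof -
  have tt: "t * t < 1"
    using t mult_strict_mono[of t 1 t 1] by simp
  define c where "c = (\<lambda>i. if i = 0 \<and> n i > 0 then t * t else 0)"
  have c: "0 \<le> c i" "c i < 1" for i using t tt by (auto simp: c_def)
  have sum: "(\<Sum>j<n i. (if i = 0 \<and> j = 0 then complex_of_real t else 0) * z *
      (if i = 0 \<and> j = 0 then complex_of_real t else 0)) = of_real (c i) * z" for i z
  proof -
    have "(\<Sum>j<n i. (if i = 0 \<and> j = 0 then complex_of_real t else 0) * z *
        (if i = 0 \<and> j = 0 then complex_of_real t else 0))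
      = (\<Sum>j<n i. if j = 0 then (if i = 0 then of_real t * of_real t * z else 0) else 0)"
      by (intro sum.cong) auto
    then show ?thesis by (simp add: c_def)
  qed
  have cnj_if: "cnj (if i = 0 \<and> j = 0 then complex_of_real t else 0)
      = (if i = 0 \<and> j = 0 then complex_of_real t else 0)" for i j :: nat by simp
  have Phi: "Phi (point t i) (n i) (smul z (mid {0})) = smul (of_real (c i) * z) (mid {0})" for i z
    unfolding Phi_def point_def madj_smul_mid mmul_smul_mid cnj_if sum[symmetric]
    by (simp add: msum_def smul_def sum_distrib_right)
  have Delta: "\<exists>d>0. foldr (\<lambda>i Z. msub Z (Phi (point t i) (n i) Z)) is (mid {0})
      = smul (complex_of_real d) (mid {0})" for "is"
  proof (induction "is")
    case Nil
    show ?case by (intro exI[of _ 1]) (simp add: smul_one)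
  next
    case (Cons i "is")
    then obtain d where d: "d > 0" "foldr (\<lambda>i Z. msub Z (Phi (point t i) (n i) Z)) is (mid {0})
      = smul (complex_of_real d) (mid {0})" by blast
    show ?case
    proof (intro exI[of _ "(1 - c i) * d"] conjI)
      show "(1 - c i) * d > 0" using c d by simp
      show "foldr (\<lambda>i Z. msub Z (Phi (point t i) (n i) Z)) (i # is) (mid {0})
          = smul (complex_of_real ((1 - c i) * d)) (mid {0})"
        by (simp add: d Phi) (simp add: msub_def smul_def algebra_simps)
    qed
  qed
  obtain d where d: "d > 0" "Delta k n (point t) (mid {0}) = smul (complex_of_real d) (mid {0})"
    using Delta[of "[0..<k]"] unfolding Delta_def by blast
  show ?thesis unfolding polyball_def
  proof (intro conjI allI impI)
    show "op_on {0} (point t i j)" for i j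
      unfolding point_def by (rule op_on_smul_mid)
    show "mmul (point t s a) (point t i b) = mmul (point t i b) (point t s a)" for s a i b
      by (simp add: point_def mmul_smul_mid)
  next
    fix i
    have "msum {..<n i} (\<lambda>j. mmul (point t i j) (madj (point t i j))) = smul (of_real (c i) * 1) (mid {0})"
      unfolding point_def madj_smul_mid mmul_smul_mid cnj_if sum[symmetric]
      by (simp add: msum_def smul_def sum_distrib_right)
    then show "mnorm (msum {..<n i} (\<lambda>j. mmul (point t i j) (madj (point t i j)))) < 1"
      using c[of i] by (simp add: mnorm_smul_mid[of 0])
  next
    show "mpos {0} (Delta k n (point t) (mid {0}))"
      unfolding mpos_def d Let_def
    proof (intro allI impI)
      fix G :: "nat set" and x :: "nat \<Rightarrow> complex" assume "finite G \<and> G \<subseteq> {0}"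
      then have "G = {} \<or> G = {0}" by auto
      then have "(\<Sum>i\<in>G. \<Sum>j\<in>G. cnj (x i) * smul (complex_of_real d) (mid {0}) i j * x j)
          = of_real (if G = {} then 0 else d * (cmod (x 0))\<^sup>2)"
        unfolding of_real_mult complex_norm_square
        by (auto simp: smul_def mid_def complex_norm_square simp del: of_real_power)
      then show "Im (\<Sum>i\<in>G. \<Sum>j\<in>G. cnj (x i) * smul (complex_of_real d) (mid {0}) i j * x j) = 0 \<and>
          0 \<le> Re (\<Sum>i\<in>G. \<Sum>j\<in>G. cnj (x i) * smul (complex_of_real d) (mid {0}) i j * x j)"
        using d(1) by simp
    qed
    show "minvertible {0} (Delta k n (point t) (mid {0}))"
      unfolding minvertible_def d
    proof (intro exI conjI)
      show "op_on {0} (smul (of_real (1 / d)) (mid {0}))"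
        by (rule op_on_smul_mid)
    qed (use d in \<open>auto simp: mmul_smul_mid smul_one\<close>)
  qed
qed

text \<open>The vector to be scaled is the boundary point \<open>point 1\<close>, a limit of the
  interior points \<open>point (1 - \<delta>)\<close>.\<close>

lemma scaled_cl_point: "scaled_cl k n (\<lambda>_ _. r) {0} (point r)"
  unfolding scaled_cl_def
proof (intro exI[of _ "point 1"] conjI allI impI)
  show "point r i j = smul (complex_of_real r) (point 1 i j)" for i j
    by (auto simp: point_def smul_def)
  show "polyball_cl k n {0} (point 1)"
    unfolding polyball_cl_def
  proof (intro conjI allI impI)
    show "op_on {0} (point 1 i j)" for i j
      unfolding point_def by (rule op_on_smul_mid)
    fix \<epsilon> :: real assume e: "\<epsilon> > 0"
    \<comment> \<open>The cap at 1 keeps 1 - \<delta> nonnegative, as \<open>polyball_point\<close>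
      requires.\<close>
    define \<delta> where "\<delta> = min 1 (\<epsilon> / 2)"
    have d: "0 < \<delta>" "\<delta> \<le> 1" "\<delta> < \<epsilon>" using e by (auto simp: \<delta>_def)
    have "mnorm (msub (point 1 i j) (point (1 - \<delta>) i j)) < \<epsilon>" for i j
    proof -
      have "msub (point 1 i j) (point (1 - \<delta>) i j) = smul (if i = 0 \<and> j = 0 then of_real \<delta> else 0) (mid {0})"
        by (auto simp: point_def msub_def smul_def algebra_simps)
      then show ?thesis using d e by (simp add: mnorm_smul_mid[of 0])
    qed
    then show "\<exists>Y. polyball k n {0} Y \<and> (\<forall>i<k. \<forall>j<n i. mnorm (msub (point 1 i j) (Y i j)) < \<epsilon>)"
      using polyball_point[of "1 - \<delta>" k n] d by auto
  qed
qed

section \<open>Moebius transforms of contractions\<close>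

text \<open>Each X_j X_j^* is dominated by their sum, whose norm is below 1. In terms of quadratic
  forms, q j is the squared norm of X_j^* x, so |X_j^* x|^2 <= |x|^2; an adjoint finishes.\<close>

lemma polyball_contraction:
  assumes X: "polyball k n D X" and i: "i < k" "j < n i"
  shows "norm_bound (X i j) 1"
proof -
  have bd: "\<exists>C. norm_bound (X i j) C" if "j < n i" for j
  proof -
    have "op_on D (X i j)" using X i that by (simp add: polyball_def)
    then show ?thesis by (rule op_on_norm_bound)
  qed
  then obtain C where C: "\<And>j. j < n i \<Longrightarrow> norm_bound (X i j) (C j)" by metis
  define R where "R = (\<lambda>j. mmul (X i j) (madj (X i j)))"
  let ?S = "msum {..<n i} R"
  have "norm_bound ?S (\<Sum>j<n i. C j * C j)"
    unfolding R_def by (intro norm_bound_msum norm_bound_mmul norm_bound_madj C) auto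
  then have "norm_bound ?S (mnorm ?S)"
    by (intro mbounded_imp_norm_bound) (auto simp: mbounded_iff)
  moreover have "mnorm ?S < 1" using X i by (simp add: polyball_def R_def)
  ultimately have S1: "norm_bound ?S 1" by (rule norm_bound_mono[OF _ less_imp_le])
  have "norm_bound (madj (X i j)) 1"
    unfolding norm_bound_def
  proof (intro allI impI)
    fix L F :: "nat set" and x :: "nat \<Rightarrow> complex"
    assume fin: "finite L" "finite F"
    define v where "v = (\<lambda>j l. \<Sum>a\<in>F. cnj (x a) * X i j a l)"
    define q where "q = (\<lambda>j. \<Sum>a\<in>F. \<Sum>b\<in>F. cnj (x a) * R j a b * x b)"
    have q: "((\<lambda>l. (cmod (v j l))\<^sup>2) has_sum Re (q j)) UNIV" if "j < n i" for j
    proof -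
      have "((\<lambda>l. \<Sum>a\<in>F. \<Sum>b\<in>F. cnj (x a) * (X i j a l * madj (X i j) l b) * x b) has_sum q j) UNIV"
        unfolding q_def R_def mmul_def
        by (intro has_sum_finite_sum fin has_sum_cmult_left has_sum_cmult_right has_sum_infsum
            norm_bound_mmul_summable[OF C norm_bound_madj[OF C]] that)
      moreover have "(\<Sum>a\<in>F. \<Sum>b\<in>F. cnj (x a) * (X i j a l * madj (X i j) l b) * x b)
          = complex_of_real ((cmod (v j l))\<^sup>2)" for l
        unfolding complex_norm_square v_def cnj_sum sum_product
        by (intro sum.cong refl) (simp add: madj_def mult_ac)
      ultimately have "((\<lambda>l. complex_of_real ((cmod (v j l))\<^sup>2)) has_sum q j) UNIV" by simp
      then show ?thesis using has_sum_Re by fastforce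
    qed
    have q0: "0 \<le> Re (q j)" if "j < n i" for j
      using q[OF that] by (rule has_sum_nonneg) auto
    have "(\<Sum>l\<in>L. (cmod (v j l))\<^sup>2) \<le> Re (q j)"
      using q[OF i(2)] by (rule finite_sum_le_has_sum) (use fin in auto)
    also have "\<dots> \<le> (\<Sum>j<n i. Re (q j))"
      using i q0 by (intro member_le_sum) auto
    also have "\<dots> = Re (\<Sum>a\<in>F. \<Sum>b\<in>F. cnj (x a) * ?S a b * x b)"
    proof -
      have "(\<Sum>a\<in>F. \<Sum>b\<in>F. cnj (x a) * ?S a b * x b)
          = (\<Sum>a\<in>F. \<Sum>b\<in>F. \<Sum>j<n i. cnj (x a) * R j a b * x b)"
        by (simp add: msum_def sum_distrib_left sum_distrib_right)
      also have "\<dots> = (\<Sum>a\<in>F. \<Sum>j<n i. \<Sum>b\<in>F. cnj (x a) * R j a b * x b)"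
        by (rule sum.cong[OF refl]) (rule sum.swap)
      also have "\<dots> = (\<Sum>j<n i. q j)"
        unfolding q_def by (rule sum.swap)
      finally show ?thesis by simp
    qed
    also have "\<dots> \<le> cmod (\<Sum>a\<in>F. \<Sum>b\<in>F. cnj (x a) * ?S a b * x b)" by (rule complex_Re_le_cmod)
    also have "\<dots> \<le> 1 * L2_set (\<lambda>a. cmod (cnj (x a))) F * L2_set (\<lambda>b. cmod (x b)) F"
      by (rule norm_bound_bilinear[OF S1 fin(2) fin(2)])
    also have "\<dots> = (L2_set (\<lambda>b. cmod (x b)) F)\<^sup>2" by (simp add: power2_eq_square)
    finally have "sqrt (\<Sum>l\<in>L. (cmod (v j l))\<^sup>2) \<le> L2_set (\<lambda>b. cmod (x b)) F"
      by (intro real_le_lsqrt) auto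
    moreover have "cmod (v j l) = cmod (\<Sum>a\<in>F. madj (X i j) l a * x a)" for l
    proof -
      have "cnj (v j l) = (\<Sum>a\<in>F. madj (X i j) l a * x a)"
        by (simp add: v_def madj_def mult.commute)
      then show ?thesis by (metis complex_mod_cnj)
    qed
    ultimately show "L2_set (\<lambda>l. cmod (\<Sum>a\<in>F. madj (X i j) l a * x a)) L \<le> 1 * L2_set (\<lambda>a. cmod (x a)) F"
      by (simp add: L2_set_def)
  qed
  from norm_bound_madj[OF this] show ?thesis by (simp add: madj_def)
qed

text \<open>Pointwise \<open>|w - a z|^2 - |a w - z|^2 = (1 - a^2) (|w|^2 - |z|^2)\<close>, and the right-hand side
  has a nonnegative sum when \<open>z = T w\<close> for a contraction \<open>T\<close>.\<close>
lemma moebius_norm_bound: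
  assumes T: "norm_bound T 1" and H: "norm_bound H b" and a: "0 \<le> a" "a \<le> 1"
    and c: "norm_bound (\<lambda>i j. H i j - complex_of_real a * mmul T H i j) c"
  shows "norm_bound (\<lambda>i j. complex_of_real a * H i j - mmul T H i j) c"
  unfolding norm_bound_def
proof (intro allI impI)
  fix F G :: "'a set" and x :: "'a \<Rightarrow> complex"
  assume fin: "finite F" "finite G"
  define w z where "w = (\<lambda>l. \<Sum>j\<in>G. H l j * x j)" and "z = (\<lambda>l. \<Sum>j\<in>G. mmul T H l j * x j)"
  \<comment> \<open>The total squared norm of w = H x, whose support may be infinite. It also
    dominates every finite section of z = T w.\<close>
  define B where "B = (SUP L\<in>{L. finite L}. \<Sum>l\<in>L. (cmod (w l))\<^sup>2)"
  let ?X = "L2_set (\<lambda>j. cmod (x j)) G"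
  have "(\<Sum>l\<in>L. (cmod (w l))\<^sup>2) \<le> (b * ?X)\<^sup>2" if "finite L" for L
  proof -
    have "(L2_set (\<lambda>l. cmod (w l)) L)\<^sup>2 \<le> (b * ?X)\<^sup>2"
      unfolding w_def using fin that by (intro power_mono norm_boundD[OF H]) auto
    then show ?thesis by (simp add: L2_set_def sum_nonneg)
  qed
  then have bdd: "bdd_above ((\<lambda>L. \<Sum>l\<in>L. (cmod (w l))\<^sup>2) ` {L. finite L})"
    by (intro bdd_aboveI2[where M = "(b * ?X)\<^sup>2"]) auto
  have wB: "(\<Sum>l\<in>L. (cmod (w l))\<^sup>2) \<le> B" if "finite L" for L
    unfolding B_def using that by (intro cSUP_upper bdd) auto
  have B0: "B \<ge> 0" using wB[of "{}"] by simp
  have zB: "(\<Sum>l\<in>L. (cmod (z l))\<^sup>2) \<le> B" if L: "finite L" for L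
  proof -
    have "L2_set (\<lambda>l. cmod (z l)) L \<le> 1 * sqrt B"
      unfolding z_def
    proof (rule mmul_vector_bound[OF T H L fin(2)])
      fix L' :: "'a set" assume "finite L'"
      then show "L2_set (\<lambda>l. cmod (\<Sum>j\<in>G. H l j * x j)) L' \<le> sqrt B"
        using wB by (simp add: L2_set_def w_def)
    qed
    then have "(L2_set (\<lambda>l. cmod (z l)) L)\<^sup>2 \<le> (sqrt B)\<^sup>2" by (intro power_mono) auto
    then show ?thesis using B0 by (simp add: L2_set_def sum_nonneg)
  qed
  have dB: "(\<Sum>l\<in>L. (cmod (w l - of_real a * z l))\<^sup>2) \<le> (c * ?X)\<^sup>2" if "finite L" for L
  proof -
    have "(L2_set (\<lambda>l. cmod (w l - of_real a * z l)) L)\<^sup>2 \<le> (c * ?X)\<^sup>2"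
      using norm_boundD[OF c that fin(2), of x]
      by (intro power_mono)
        (auto simp: w_def z_def left_diff_distrib sum_subtractf sum_distrib_left mult.assoc)
    then show ?thesis by (simp add: L2_set_def sum_nonneg)
  qed
  have pw: "(cmod (of_real a * u - v))\<^sup>2 = (cmod (u - of_real a * v))\<^sup>2 - (1 - a\<^sup>2) * ((cmod u)\<^sup>2 - (cmod v)\<^sup>2)"
    for u v :: complex
    unfolding cmod_power2 by (simp add: algebra_simps power2_eq_square)
  have "(\<Sum>l\<in>F. (cmod (of_real a * w l - z l))\<^sup>2) \<le> (c * ?X)\<^sup>2"
  proof (rule field_le_epsilon)
    fix e :: real assume "e > 0"
    then have "B - e < B" by simp
    \<comment> \<open>A section of z is not bounded by the same section of w. Enlarging F by a set
      that carries all but e of the total B repairs this up to an error e.\<close>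
    then obtain L where L: "finite L" "B - e < (\<Sum>l\<in>L. (cmod (w l))\<^sup>2)"
      unfolding B_def using bdd by (subst (asm) less_cSUP_iff) auto
    let ?F = "F \<union> L"
    have finF: "finite ?F" using fin L by simp
    have "B - e < (\<Sum>l\<in>?F. (cmod (w l))\<^sup>2)"
      using L(2) by (rule less_le_trans) (use finF in \<open>auto intro: sum_mono2\<close>)
    then have *: "(\<Sum>l\<in>?F. (cmod (w l))\<^sup>2) - (\<Sum>l\<in>?F. (cmod (z l))\<^sup>2) \<ge> - e"
      using zB[OF finF] by linarith
    have "0 \<le> 1 - a\<^sup>2" "1 - a\<^sup>2 \<le> 1" using a by (auto simp: power_le_one)
    then have "(1 - a\<^sup>2) * e \<le> e" using \<open>e > 0\<close> by (simp add: mult_left_le_one_le)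
    moreover have "(1 - a\<^sup>2) * (- e) \<le> (1 - a\<^sup>2) * ((\<Sum>l\<in>?F. (cmod (w l))\<^sup>2) - (\<Sum>l\<in>?F. (cmod (z l))\<^sup>2))"
      using * \<open>0 \<le> 1 - a\<^sup>2\<close> by (rule mult_left_mono)
    ultimately have "(1 - a\<^sup>2) * ((\<Sum>l\<in>?F. (cmod (w l))\<^sup>2) - (\<Sum>l\<in>?F. (cmod (z l))\<^sup>2)) \<ge> - e" by simp
    moreover have "(\<Sum>l\<in>?F. (cmod (of_real a * w l - z l))\<^sup>2)
      = (\<Sum>l\<in>?F. (cmod (w l - of_real a * z l))\<^sup>2)
        - (1 - a\<^sup>2) * ((\<Sum>l\<in>?F. (cmod (w l))\<^sup>2) - (\<Sum>l\<in>?F. (cmod (z l))\<^sup>2))"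
      unfolding pw by (simp only: sum_subtractf sum_distrib_left right_diff_distrib)
    moreover have "(\<Sum>l\<in>F. (cmod (of_real a * w l - z l))\<^sup>2) \<le> (\<Sum>l\<in>?F. (cmod (of_real a * w l - z l))\<^sup>2)"
      using finF by (intro sum_mono2) auto
    ultimately show "(\<Sum>l\<in>F. (cmod (of_real a * w l - z l))\<^sup>2) \<le> (c * ?X)\<^sup>2 + e"
      using dB[OF finF] by linarith
  qed
  then have "L2_set (\<lambda>l. cmod (of_real a * w l - z l)) F \<le> sqrt ((c * ?X)\<^sup>2)"
    unfolding L2_set_def by (rule real_sqrt_le_mono)
  then show "L2_set (\<lambda>i. cmod (\<Sum>j\<in>G. (complex_of_real a * H i j - mmul T H i j) * x j)) F \<le> c * ?X"
    using norm_bound_nonneg[OF c]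
    by (simp add: w_def z_def left_diff_distrib sum_subtractf sum_distrib_left mult.assoc)
qed

text \<open>The Weierstrass test: S is the entrywise sum, and its distance to a partial sum is
  bounded by the tail of g, by letting m grow in the blocks from N to N + m.\<close>

lemma mconv_summable:
  assumes T: "\<And>q. norm_bound (T q) (g q)" and g: "summable g"
  shows "\<exists>S. mconv (\<lambda>N. msum {..<N} T) S"
proof -
  define S where "S = (\<lambda>i j. \<Sum>q. T q i j)"
  have "summable (\<lambda>q. T q i j)" for i j
    using g by (rule summable_comparison_test'[where N = 0]) (rule norm_bound_entry[OF T])
  then have lim: "(\<lambda>N. msum {..<N} T i j) \<longlonglongrightarrow> S i j" for i j
    unfolding S_def msum_def by (rule summable_LIMSEQ)
  have tail: "norm_bound (msub S (msum {..<N} T)) (suminf g - sum g {..<N})" for N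
  proof (rule norm_bound_limit)
    fix m
    have "msum {N..<N + m} T = msub (msum {..<N + m} T) (msum {..<N} T)"
      by (simp add: msub_def msum_def fun_eq_iff sum_diff_nat_ivl[of 0, simplified, unfolded atLeast0LessThan])
    moreover have "sum g {N..<N + m} = sum g {..<N + m} - sum g {..<N}"
      by (simp add: sum_diff_nat_ivl[of 0, simplified, unfolded atLeast0LessThan])
    moreover have "norm_bound (msum {N..<N + m} T) (sum g {N..<N + m})"
      by (rule norm_bound_msum) (auto simp: T)
    ultimately show "norm_bound (msub (msum {..<N + m} T) (msum {..<N} T)) (sum g {..<N + m} - sum g {..<N})"
      by simp
  next
    have shift: "filterlim (\<lambda>m. N + m) sequentially sequentially"
      by (rule filterlim_add_const_nat_at_top[of N, unfolded add.commute[of _ N]])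
    show "(\<lambda>m. msub (msum {..<N + m} T) (msum {..<N} T) i j) \<longlonglongrightarrow> msub S (msum {..<N} T) i j" for i j
      unfolding msub_def by (intro tendsto_diff tendsto_const filterlim_compose[OF lim shift])
    show "(\<lambda>m. sum g {..<N + m} - sum g {..<N}) \<longlonglongrightarrow> suminf g - sum g {..<N}"
      by (intro tendsto_diff tendsto_const filterlim_compose[OF summable_LIMSEQ[OF g] shift])
  qed
  have "norm_bound S (suminf g)"
    using tail[of 0] by (simp add: msub_def msum_def)
  moreover have "(\<lambda>N. suminf g - sum g {..<N}) \<longlonglongrightarrow> 0"
    using tendsto_diff[OF tendsto_const summable_LIMSEQ[OF g], of "suminf g"] by simp
  ultimately have "mconv (\<lambda>N. msum {..<N} T) S" by (rule mconvI[OF _ tail])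
  then show ?thesis by blast
qed


section \<open>The extremal test functions\<close>

text \<open>The multi-word of the monomial \<open>X_(1,1)^q\<close>.\<close>

definition pure_word :: "nat \<Rightarrow> nat \<Rightarrow> nat list" where
  "pure_word q = (\<lambda>i. if i = 0 then replicate q 0 else [])"

text \<open>The Taylor coefficients of \<open>(a - z) / (1 - a z)\<close>.\<close>
definition moebius_coeff :: "real \<Rightarrow> nat \<Rightarrow> real" where
  "moebius_coeff a q = (if q = 0 then a else - (1 - a\<^sup>2) * a ^ (q - 1))"

definition moebius_series :: "real \<Rightarrow> (nat \<Rightarrow> nat list) \<Rightarrow> complex" where
  "moebius_series a \<alpha> =
     (if \<alpha> = pure_word (length (\<alpha> 0)) then of_real (moebius_coeff a (length (\<alpha> 0))) else 0)"

lemma length_pure_word: "length (pure_word q 0) = q"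
  by (simp add: pure_word_def)

text \<open>Covers both a \<open>DegSet\<close>, for the partial sums, and a \<open>Lam\<close>, for
  the homogeneous parts; pure words of one length only occur in them.\<close>

lemma sum_moebius_series:
  assumes "finite S" "pure_word q \<in> S" "\<And>\<alpha>. \<alpha> \<in> S \<Longrightarrow> \<alpha> = pure_word (length (\<alpha> 0)) \<Longrightarrow> length (\<alpha> 0) = q"
  shows "msum S (sc_term k (moebius_series a) D X)
    = smul (of_real (moebius_coeff a q)) (mono k D X (pure_word q))"
proof (intro ext)
  fix x y
  have "(\<Sum>\<alpha>\<in>S. sc_term k (moebius_series a) D X \<alpha> x y)
      = (\<Sum>\<alpha>\<in>S. if \<alpha> = pure_word q then smul (of_real (moebius_coeff a q)) (mono k D X \<alpha>) x y else 0)"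
  proof (rule sum.cong[OF refl])
    fix \<alpha> assume \<alpha>: "\<alpha> \<in> S"
    show "sc_term k (moebius_series a) D X \<alpha> x y
      = (if \<alpha> = pure_word q then smul (of_real (moebius_coeff a q)) (mono k D X \<alpha>) x y else 0)"
    proof (cases "\<alpha> = pure_word q")
      case True
      then show ?thesis by (simp add: sc_term_def moebius_series_def length_pure_word)
    next
      case False
      then have "\<alpha> \<noteq> pure_word (length (\<alpha> 0))" using assms(3)[OF \<alpha>] by metis
      then show ?thesis using False by (simp add: sc_term_def moebius_series_def smul_def)
    qed
  qed
  then show "msum S (sc_term k (moebius_series a) D X) x y
      = smul (of_real (moebius_coeff a q)) (mono k D X (pure_word q)) x y"
    using assms(1,2) by (simp add: msum_def)
qed

lemma tup_pure_word: "k \<ge> 1 \<Longrightarrow> n 0 \<ge> 1 \<Longrightarrow> tup k n (pure_word q)"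
  by (auto simp: tup_def pure_word_def)

lemma sum_length_pure_word: "k \<ge> 1 \<Longrightarrow> (\<Sum>i<k. length (pure_word q i)) = q"
proof -
  assume "k \<ge> 1"
  have "(\<Sum>i<k. length (pure_word q i)) = (\<Sum>i<k. if i = 0 then q else 0)"
    by (intro sum.cong) (auto simp: pure_word_def)
  then show ?thesis using \<open>k \<ge> 1\<close> by simp
qed

lemma mono_pure_word:
  assumes "k \<ge> 1" "op_on D (X 0 0)"
  shows "mono k D X (pure_word q) = wprod D (X 0) (replicate q 0)"
proof -
  have mm: "mmul (mid D) (mid D) = mid D" by (rule mmul_mid_left) (simp add: mid_def)
  have "foldr (\<lambda>i M. mmul (wprod D (X i) (pure_word q i)) M) is (mid D) = mid D" if "0 \<notin> set is" for "is"
    using that by (induction "is") (auto simp: pure_word_def mm)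
  from this[of "[1..<k]"] have "mono k D X (pure_word q) = mmul (wprod D (X 0) (replicate q 0)) (mid D)"
    using assms(1) by (simp add: mono_def upt_conv_Cons pure_word_def)
  also have "\<dots> = wprod D (X 0) (replicate q 0)"
  proof (rule mmul_mid_right)
    have "op_on D (wprod D (X 0) (replicate q 0))"
      using assms(2) by (intro op_on_wprod[where N = 1]) auto
    then show "wprod D (X 0) (replicate q 0) i j = 0" if "j \<notin> D" for i j
      using that by (simp add: op_on_def)
  qed
  finally show ?thesis .
qed

text \<open>Coefficient comparison in (a - z) times the geometric series of a z.\<close>

lemma moebius_coeff_cancel:
  "a * a ^ q - (if q = 0 then 0 else a ^ (q - 1)) = moebius_coeff a q"
  by (cases q) (auto simp: moebius_coeff_def algebra_simps power2_eq_square)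

text \<open>The truncated geometric series H replaces the inverse of 1 - a T. Then (1 - a T) H = I -
  a^(N+1) T^(N+1), so \<open>moebius_norm_bound\<close> bounds (a - T) H by 1 + a^(N+1). The partial
  sum is (a - T) H plus the boundary term a^N T^(N+1); both errors vanish as N grows.\<close>

lemma moebius_partial_sum_bound:
  assumes T: "norm_bound T 1" and a: "0 \<le> a" "a \<le> 1"
    and pw: "pw 0 = mid D" "\<And>q. pw (Suc q) = mmul T (pw q)"
  shows "norm_bound (msum {..<Suc N} (\<lambda>q. smul (of_real (moebius_coeff a q)) (pw q))) (1 + a ^ Suc N + a ^ N)"
proof -
  have pw1: "norm_bound (pw q) 1" for q
  proof (induction q)
    case (Suc q)
    then show ?case using norm_bound_mmul[OF T Suc] by (simp add: pw)
  qed (simp add: pw norm_bound_mid)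
  define H where "H = msum {..<Suc N} (\<lambda>q. smul (of_real (a ^ q)) (pw q))"
  have H: "norm_bound H (\<Sum>q<Suc N. cmod (of_real (a ^ q)) * 1)"
    unfolding H_def by (intro norm_bound_msum norm_bound_smul pw1) simp
  have TH: "mmul T H i j = (\<Sum>q<Suc N. of_real (a ^ q) * pw (Suc q) i j)" for i j
  proof -
    have "((\<lambda>l. \<Sum>q<Suc N. of_real (a ^ q) * (T i l * pw q l j)) has_sum
        (\<Sum>q<Suc N. of_real (a ^ q) * pw (Suc q) i j)) UNIV"
      unfolding pw(2) mmul_def
      by (intro has_sum_finite_sum has_sum_cmult_right has_sum_infsum norm_bound_mmul_summable[OF T pw1]) simp
    then have "((\<lambda>l. T i l * H l j) has_sum (\<Sum>q<Suc N. of_real (a ^ q) * pw (Suc q) i j)) UNIV"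
      by (simp only: H_def msum_def smul_def sum_distrib_left mult.left_commute)
    then show ?thesis unfolding mmul_def by (rule infsumI)
  qed
  have "(\<lambda>i j. H i j - of_real a * mmul T H i j) = msub (mid D) (smul (of_real (a ^ Suc N)) (pw (Suc N)))"
  proof (intro ext)
    fix i j
    have "H i j - of_real a * mmul T H i j
        = (\<Sum>q<Suc N. of_real (a ^ q) * pw q i j - of_real (a ^ Suc q) * pw (Suc q) i j)"
      unfolding TH unfolding H_def msum_def smul_def sum_distrib_left sum_subtractf by (simp add: mult.assoc)
    also have "\<dots> = pw 0 i j - of_real (a ^ Suc N) * pw (Suc N) i j"
      by (subst sum_lessThan_telescope') simp
    finally show "H i j - of_real a * mmul T H i j = msub (mid D) (smul (of_real (a ^ Suc N)) (pw (Suc N))) i j"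
      by (simp add: msub_def smul_def pw(1))
  qed
  moreover have "norm_bound (msub (mid D) (smul (of_real (a ^ Suc N)) (pw (Suc N)))) (1 + cmod (of_real (a ^ Suc N)) * 1)"
    by (intro norm_bound_sub norm_bound_mid norm_bound_smul pw1)
  ultimately have "norm_bound (\<lambda>i j. H i j - of_real a * mmul T H i j) (1 + a ^ Suc N)"
    using a by (simp only: norm_of_real) simp
  then have "norm_bound (\<lambda>i j. of_real a * H i j - mmul T H i j) (1 + a ^ Suc N)"
    by (rule moebius_norm_bound[OF T H a])
  then have "norm_bound (\<lambda>i j. (of_real a * H i j - mmul T H i j) + smul (of_real (a ^ N)) (pw (Suc N)) i j)
      (1 + a ^ Suc N + cmod (of_real (a ^ N)) * 1)"
    by (intro norm_bound_add norm_bound_smul pw1)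
  moreover have "(\<lambda>i j. (of_real a * H i j - mmul T H i j) + smul (of_real (a ^ N)) (pw (Suc N)) i j)
      = msum {..<Suc N} (\<lambda>q. smul (of_real (moebius_coeff a q)) (pw q))"
  proof (intro ext)
    fix i j
    let ?c = "\<lambda>q. complex_of_real (if q = 0 then 0 else a ^ (q - 1))"
    have "(\<Sum>q<Suc N. of_real (a ^ q) * pw (Suc q) i j)
        = (\<Sum>q<Suc N. ?c (Suc q) * pw (Suc q) i j)" by simp
    also have "\<dots> = (\<Sum>q<Suc (Suc N). ?c q * pw q i j)"
      by (subst sum.lessThan_Suc_shift) simp
    also have "\<dots> = (\<Sum>q<Suc N. ?c q * pw q i j) + of_real (a ^ N) * pw (Suc N) i j" by simp
    finally have "of_real a * H i j - mmul T H i j + of_real (a ^ N) * pw (Suc N) i j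
        = (\<Sum>q<Suc N. of_real (a * a ^ q) * pw q i j - ?c q * pw q i j)"
      unfolding TH unfolding H_def msum_def smul_def sum_distrib_left sum_subtractf by (simp add: mult.assoc)
    also have "\<dots> = (\<Sum>q<Suc N. of_real (moebius_coeff a q) * pw q i j)"
      unfolding moebius_coeff_cancel[symmetric] by (simp only: of_real_diff left_diff_distrib)
    finally show "(of_real a * H i j - mmul T H i j) + smul (of_real (a ^ N)) (pw (Suc N)) i j
        = msum {..<Suc N} (\<lambda>q. smul (of_real (moebius_coeff a q)) (pw q)) i j"
      by (simp add: msum_def smul_def)
  qed
  ultimately show ?thesis using a by (simp add: norm_power)
qed

text \<open>An instance of von Neumann's inequality. Convergence comes from the geometric decay of
  the coefficients, the bound 1 from the limit of the partial sum estimates.\<close>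

lemma moebius_series_limit:
  assumes k: "k \<ge> 1" "n 0 \<ge> 1" and a: "0 \<le> a" "a < 1" and X: "polyball k n D X"
  shows "\<exists>S. mconv (psums k n (sc_term k (moebius_series a) D X)) S \<and> norm_bound S 1"
proof -
  define pw where "pw = (\<lambda>q. wprod D (X 0) (replicate q 0))"
  have pw: "pw 0 = mid D" "pw (Suc q) = mmul (X 0 0) (pw q)" for q by (auto simp: pw_def)
  have T: "norm_bound (X 0 0) 1" using polyball_contraction[OF X] k by simp
  have op: "op_on D (X 0 0)" using X k by (simp add: polyball_def)
  have pw1: "norm_bound (pw q) 1" for q
  proof (induction q)
    case (Suc q)
    then show ?case using norm_bound_mmul[OF T Suc] by (simp add: pw)
  qed (simp add: pw norm_bound_mid)
  let ?T = "\<lambda>q. smul (of_real (moebius_coeff a q)) (pw q)"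
  have "msum (DegSet k n q) (sc_term k (moebius_series a) D X) = ?T q" for q
    unfolding pw_def mono_pure_word[where X = X, OF k(1) op, symmetric]
  proof (rule sum_moebius_series)
    show "pure_word q \<in> DegSet k n q"
      using tup_pure_word[where n = n, OF k] sum_length_pure_word[OF k(1)] by (simp add: DegSet_def)
    fix \<alpha> assume "\<alpha> \<in> DegSet k n q" "\<alpha> = pure_word (length (\<alpha> 0))"
    moreover from this(2) have "(\<Sum>i<k. length (\<alpha> i)) = length (\<alpha> 0)"
      using sum_length_pure_word[OF k(1), of "length (\<alpha> 0)"] by metis
    ultimately show "length (\<alpha> 0) = q" by (simp only: DegSet_def mem_Collect_eq)
  qed (rule finite_DegSet)
  then have ps: "psums k n (sc_term k (moebius_series a) D X) = (\<lambda>N. msum {..<N} ?T)"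
    by (intro ext) (simp add: psums_def)
  have "norm_bound (?T q) (\<bar>moebius_coeff a q\<bar>)" for q
    using norm_bound_smul[OF pw1, of "of_real (moebius_coeff a q)"] by simp
  moreover have "summable (\<lambda>q. \<bar>moebius_coeff a q\<bar>)"
  proof -
    have "summable (\<lambda>q. \<bar>1 - a\<^sup>2\<bar> * a ^ q)" using a by (intro summable_mult summable_geometric) simp
    then have "summable (\<lambda>q. \<bar>moebius_coeff a (Suc q)\<bar>)"
      using a by (simp add: moebius_coeff_def abs_mult)
    then show ?thesis by (subst (asm) summable_Suc_iff)
  qed
  ultimately have "\<exists>S. mconv (\<lambda>N. msum {..<N} ?T) S" by (rule mconv_summable)
  then obtain S where S: "mconv (\<lambda>N. msum {..<N} ?T) S" by blast
  have "norm_bound S (1 + 0 + 0)"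
  proof (rule norm_bound_limit)
    show "norm_bound (msum {..<Suc N} ?T) (1 + a ^ Suc N + a ^ N)" for N
      using T a pw by (intro moebius_partial_sum_bound) auto
    show "(\<lambda>N. msum {..<Suc N} ?T i j) \<longlonglongrightarrow> S i j" for i j
      using mconv_entry[OF S] by (rule LIMSEQ_Suc)
    have "(\<lambda>N. a ^ N) \<longlonglongrightarrow> 0" using a by (intro LIMSEQ_realpow_zero) auto
    then show "(\<lambda>N. 1 + a ^ Suc N + a ^ N) \<longlonglongrightarrow> 1 + 0 + 0"
      by (intro tendsto_add tendsto_const LIMSEQ_Suc)
  qed
  then show ?thesis using S ps by auto
qed

lemma sc_evalI: "mconv (psums k n (sc_term k c D X)) S \<Longrightarrow> sc_eval k n c D X = S"
  unfolding sc_eval_def by (rule the_equality) (auto intro: mconv_unique)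

lemma fh_evalI: "mconv (psums k n (fh_term k A D X)) S \<Longrightarrow> fh_eval k n A D X = S"
  unfolding fh_eval_def by (rule the_equality) (auto intro: mconv_unique)

lemma Hinf_moebius:
  assumes k: "k \<ge> 1" "n 0 \<ge> 1" and a: "0 \<le> a" "a < 1"
  shows "Hinf k n (moebius_series a)" and "Hinf_norm k n (moebius_series a) \<le> 1"
proof -
  have le: "mnorm (sc_eval k n (moebius_series a) D X) \<le> 1" if X: "polyball k n D X" for D X
  proof -
    obtain S where S: "mconv (psums k n (sc_term k (moebius_series a) D X)) S" "norm_bound S 1"
      using moebius_series_limit[where n = n, OF k a X] by blast
    then show ?thesis using norm_bound_imp_mnorm_le(2)[OF S(2)] by (simp add: sc_evalI[OF S(1)])
  qed
  show "Hinf k n (moebius_series a)"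
    unfolding Hinf_def
  proof (intro conjI allI impI)
    show "bdd_above {mnorm (sc_eval k n (moebius_series a) D X) |D X. polyball k n D X}"
      using le by (intro bdd_aboveI[of _ 1]) auto
  qed (use moebius_series_limit[where n = n, OF k a] in blast)
  \<comment> \<open>The supremum in \<open>Hinf_norm\<close> needs a nonempty set.\<close>
  have "polyball k n {0} (point 0)" by (rule polyball_point) auto
  then show "Hinf_norm k n (moebius_series a) \<le> 1"
    unfolding Hinf_norm_def using le by (intro cSup_least) auto
qed

text \<open>At the scalar point, the multi-indices (q, 0, ..., 0) contribute these terms and all
  others are nonnegative; the whole sum is at most the norm of the test function.\<close>

lemma bohr_ok_moebius:
  assumes k: "k \<ge> 1" "n 0 \<ge> 1" and a: "0 \<le> a" "a < 1" and r: "0 \<le> r" and ok: "bohr_ok k n r"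
  shows "(\<Sum>q<N. \<bar>moebius_coeff a q\<bar> * r ^ q) \<le> 1"
proof -
  define h where "h = (\<lambda>p. mnorm (msum (Lam k n p) (sc_term k (moebius_series a) {0} (point r))))"
  have sm: "h summable_on Mindex k" and le: "infsum h (Mindex k) \<le> Hinf_norm k n (moebius_series a)"
    using ok Hinf_moebius(1)[where n = n, OF k a] scaled_cl_point[of k n r] unfolding bohr_ok_def Let_def h_def
    by blast+
  define e where "e = (\<lambda>q (i :: nat). if i = 0 then q else 0 :: nat)"
  have e: "e q \<in> Mindex k" for q using k by (auto simp: e_def Mindex_def)
  have inj: "inj e"
  proof (rule injI)
    fix q q' assume "e q = e q'"
    then have "e q 0 = e q' 0" by simp
    then show "q = q'" by (simp add: e_def)
  qed
  have he: "h (e q) = \<bar>moebius_coeff a q\<bar> * r ^ q" for q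
  proof -
    have pw: "wprod {0} (point r 0) (replicate q 0) = smul (of_real (r ^ q)) (mid {0})" for q
      by (induction q) (auto simp: smul_one point_def mmul_smul_mid)
    have "msum (Lam k n (e q)) (sc_term k (moebius_series a) {0} (point r))
        = smul (of_real (moebius_coeff a q)) (mono k {0} (point r) (pure_word q))"
    proof (rule sum_moebius_series[OF finite_Lam])
      show "pure_word q \<in> Lam k n (e q)"
        using tup_pure_word[where n = n, OF k] by (auto simp: Lam_def e_def pure_word_def)
      show "length (\<alpha> 0) = q" if "\<alpha> \<in> Lam k n (e q)" for \<alpha>
        using that k by (auto simp: Lam_def e_def)
    qed
    also have "mono k {0} (point r) (pure_word q) = smul (of_real (r ^ q)) (mid {0})"
      using k(1) by (subst mono_pure_word) (auto simp: pw point_def op_on_smul_mid)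
    finally show ?thesis
      using r unfolding h_def by (simp add: smul_smul mnorm_smul_mid[of 0] norm_mult norm_power)
  qed
  have hpos: "0 \<le> h p" if p: "p \<in> Mindex k" for p
  proof -
    have "norm_bound (msum (Lam k n p) (sc_term k (moebius_series a) {0} (point r)))
      (\<Sum>\<alpha>\<in>Lam k n p. cmod (moebius_series a \<alpha>) * C \<alpha>)"
      if "\<And>\<alpha>. \<alpha> \<in> Lam k n p \<Longrightarrow> norm_bound (mono k {0} (point r) \<alpha>) (C \<alpha>)" for C
      unfolding sc_term_def by (intro norm_bound_msum finite_Lam norm_bound_smul that)
    moreover have "\<exists>C. norm_bound (mono k {0} (point r) \<alpha>) C" if "\<alpha> \<in> Lam k n p" for \<alpha>
    proof (rule op_on_norm_bound[of "{0}"], rule op_on_mono)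
      show "\<forall>i<k. \<forall>j<n i. op_on {0} (point r i j)" by (simp add: point_def op_on_smul_mid)
    qed (use that in \<open>simp add: Lam_def\<close>)
    ultimately have "mbounded (msum (Lam k n p) (sc_term k (moebius_series a) {0} (point r)))"
      unfolding mbounded_iff by metis
    then show ?thesis unfolding h_def by (rule mnorm_nonneg)
  qed
  have "(\<Sum>q<N. \<bar>moebius_coeff a q\<bar> * r ^ q) = sum h (e ` {..<N})"
    by (subst sum.reindex) (auto simp: he intro: inj_on_subset[OF inj])
  also have "\<dots> \<le> infsum h (Mindex k)"
    using sm e hpos by (intro finite_sum_le_infsum) auto
  also have "\<dots> \<le> 1" using le Hinf_moebius(2)[where n = n, OF k a] by simp
  finally show ?thesis .
qed

text \<open>Summing the series gives a + (1 - a^2) s / (1 - a s) <= 1; clearing the denominator and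
  cancelling 1 - a leaves s (1 + 2 a) <= 1. As a tends to 1 this forbids s > 1/3.\<close>

lemma bohr_ok_le_third:
  assumes k: "k \<ge> 1" "n 0 \<ge> 1" and r: "0 \<le> r" and ok: "bohr_ok k n r"
  shows "r \<le> 1/3"
proof (rule ccontr)
  assume "\<not> r \<le> 1/3"
  \<comment> \<open>The radius r could be 1 or more. Shrinking it to at most 1/2 makes the geometric
    series converge, and the sums only decrease.\<close>
  define s where "s = min r (1/2)"
  have s: "1/3 < s" "s \<le> 1/2" "s \<le> r" using \<open>\<not> r \<le> 1/3\<close> by (auto simp: s_def)
  have *: "s * (1 + 2 * a) \<le> 1" if a: "0 \<le> a" "a < 1" for a
  proof -
    have as: "a * s < 1" using a s mult_strict_mono[of a 1 s 1] by simp
    have "a\<^sup>2 \<le> 1" using a by (simp add: power_le_one)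
    have "a + (1 - a\<^sup>2) * s * (\<Sum>q<N. (a * s) ^ q) \<le> 1" for N
    proof -
      have "a + (1 - a\<^sup>2) * s * (\<Sum>q<N. (a * s) ^ q) = (\<Sum>q<Suc N. \<bar>moebius_coeff a q\<bar> * s ^ q)"
        using a \<open>a\<^sup>2 \<le> 1\<close> unfolding sum.lessThan_Suc_shift
        by (simp add: moebius_coeff_def abs_mult sum_distrib_left power_mult_distrib mult_ac)
      also have "\<dots> \<le> (\<Sum>q<Suc N. \<bar>moebius_coeff a q\<bar> * r ^ q)"
        using s by (intro sum_mono mult_left_mono power_mono) auto
      also have "\<dots> \<le> 1" by (rule bohr_ok_moebius[where k = k and n = n]) (use k a r ok in auto)
      finally show ?thesis .
    qed
    moreover have "(\<lambda>N. a + (1 - a\<^sup>2) * s * (\<Sum>q<N. (a * s) ^ q)) \<longlonglongrightarrow> a + (1 - a\<^sup>2) * s * (1 / (1 - a * s))"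
      using geometric_sums[of "a * s"] a s as unfolding sums_def
      by (intro tendsto_add tendsto_mult tendsto_const) auto
    ultimately have "a + (1 - a\<^sup>2) * s * (1 / (1 - a * s)) \<le> 1"
      by (intro LIMSEQ_le_const2) auto
    then have "(1 - a\<^sup>2) * s \<le> (1 - a) * (1 - a * s)"
      using as by (simp add: field_simps)
    moreover have "(1 - a\<^sup>2) * s = (1 - a) * ((1 + a) * s)"
      by (simp add: power2_eq_square algebra_simps)
    ultimately have "(1 + a) * s \<le> 1 - a * s" using a by simp
    then show ?thesis by (simp add: algebra_simps)
  qed
  \<comment> \<open>The root of s (1 + 2 c) = 1. It lies below 1 because s > 1/3, so the midpoint of
    c and 1 contradicts the inequality.\<close>
  define c where "c = (1 / s - 1) / 2"
  have c: "c < 1" "0 \<le> c" using s by (auto simp: c_def field_simps)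
  have "2 * c = 1 / s - 1" unfolding c_def by simp
  then have "s * (1 + 2 * c) = 1" using s by simp
  moreover have "s * (1 + 2 * c) < s * (1 + 2 * ((c + 1) / 2))" using c s by simp
  ultimately show False using *[of "(c + 1) / 2"] c by simp
qed

section \<open>The Bohr inequalities\<close>

interpretation op_frame: coefficient_frame fst snd "\<lambda>m x. (fst x, prod_encode (snd x, m))"
  by unfold_locales (auto simp: prod_eq_iff)

text \<open>Here K = l2({0}), so the K-component of every index is 0 and scalars are operators on
  K.\<close>

interpretation sc_frame: coefficient_frame "\<lambda>_. 0" id "\<lambda>m x. prod_encode (x, m)"
  by unfold_locales auto

lemma gterm_op: "op_frame.gterm A k D X = fh_term k A D X"
  by (simp add: op_frame.gterm_def fh_term_def mtensor_def fun_eq_iff)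

lemma gterm_sc: "sc_frame.gterm (\<lambda>\<alpha>. smul (c \<alpha>) (mid {0})) k D X = sc_term k c D X"
  by (simp add: sc_frame.gterm_def sc_term_def smul_def mid_def fun_eq_iff)

text \<open>\<open>(M^2 - |a0|^2) / M \<le> 2 (M - |a0|)\<close>, so that a majorant factor \<open>1/2\<close> is affordable.\<close>
lemma bohr_inequality:
  fixes c M Q :: real
  assumes "0 \<le> c" "c \<le> M" "Q \<le> 3/2"
  shows "c + (M\<^sup>2 - c\<^sup>2) / M * (Q - 1) \<le> M"
\<comment> \<open>For M = 0 the quotient is 0 by convention, and c = 0 follows from c <= M.\<close>
proof (cases "M = 0")
  case False
  then have M: "M > 0" using assms by simp
  have "(M\<^sup>2 - c\<^sup>2) / M * (Q - 1) \<le> (M\<^sup>2 - c\<^sup>2) / M * (1/2)"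
    using assms M by (intro mult_left_mono) (auto simp: power_mono)
  also have "\<dots> \<le> M - c"
  proof -
    have "M\<^sup>2 - c\<^sup>2 = (M - c) * (M + c)" by (simp add: power2_eq_square algebra_simps)
    also have "\<dots> \<le> (M - c) * (2 * M)" using assms by (intro mult_left_mono) auto
    finally show ?thesis using M by (simp add: field_simps)
  qed
  finally show ?thesis by simp
qed (use assms in auto)

text \<open>The majorant estimate with M the norm of the function itself; the hypothesis on r makes
  the product of the k factors 1 / (1 - r) at most 3/2.\<close>

lemma bohr_ok_of_prod:
  assumes r: "0 \<le> r" "r < 1" and rk: "(1 - r) ^ k \<ge> 2/3"
  shows "bohr_ok k n r"
  unfolding bohr_ok_def Let_def
proof (intro allI impI)
  fix c :: "(nat \<Rightarrow> nat list) \<Rightarrow> complex" and D X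
  assume H: "Hinf k n c" and X: "scaled_cl k n (\<lambda>_ _. r) D X"
  define M where "M = Hinf_norm k n c"
  let ?A = "\<lambda>\<alpha>. smul (c \<alpha>) (mid {0::nat})"
  have bounded: "sc_frame.bounded_series k n ?A M"
    unfolding sc_frame.bounded_series_def gterm_sc
  proof (intro allI impI)
    fix D Y assume Y: "polyball k n D Y"
    then obtain S where S: "mconv (psums k n (sc_term k c D Y)) S"
      using H unfolding Hinf_def by blast
    have "mnorm S \<in> {mnorm (sc_eval k n c D X) |D X. polyball k n D X}"
      using Y sc_evalI[OF S] by blast
    then have "mnorm S \<le> M"
      unfolding M_def Hinf_norm_def using H unfolding Hinf_def by (intro cSup_upper) auto
    then show "\<exists>S. mconv (psums k n (sc_term k c D Y)) S \<and> norm_bound S M"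
      using S norm_bound_mono[OF mconvD(1)[OF S]] by blast
  qed
  have supp: "?A \<alpha> u v = 0" if "u \<notin> {0} \<or> v \<notin> {0}" for \<alpha> u v
    using that by (auto simp: smul_def mid_def)
  have c0: "cmod (c g0) \<le> M"
    by (rule sc_frame.cmod_constant_le[OF bounded supp refl polyball_point[of 0], of 0]) auto
  have prod: "(\<Prod>i<k. 1 / (1 - r)) \<le> 3/2"
    using rk r by (simp add: power_one_over field_simps)
  note maj = sc_frame.majorant_series_bound[where r = "\<lambda>_. r", OF bounded supp refl X c0, unfolded gterm_sc]
  show "(\<lambda>p. mnorm (msum (Lam k n p) (sc_term k c D X))) summable_on Mindex k \<and>
      (\<Sum>\<^sub>\<infinity>p\<in>Mindex k. mnorm (msum (Lam k n p) (sc_term k c D X))) \<le> Hinf_norm k n c"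
    using maj r order_trans[OF _ bohr_inequality[OF norm_ge_zero c0 prod]] by (simp add: M_def)
qed

theorem theorem2p9:
  fixes k :: nat and n :: "nat \<Rightarrow> nat"
  assumes "k \<ge> 1" and "\<forall>i<k. n i \<ge> 1"
  shows
   "(\<forall>(DK :: nat set) (A :: (nat \<Rightarrow> nat list) \<Rightarrow> nat mat) (a0 :: complex) (r :: nat \<Rightarrow> real)
        (D :: nat set) (X :: nat \<Rightarrow> nat \<Rightarrow> nat mat).
       DK \<noteq> {} \<and> is_fh k n DK A \<and>
       (\<forall>D' X'. polyball k n D' X' \<longrightarrow> mnorm (fh_eval k n A D' X') \<le> 1) \<and>
       A g0 = smul a0 (mid DK) \<and>
       (\<forall>i<k. 0 \<le> r i \<and> r i < 1) \<and>
       scaled_cl k n (\<lambda>i j. r i) D X \<longrightarrow>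
       (let h = (\<lambda>p. mnorm (msum (Lam k n p) (fh_term k A D X))) in
          h summable_on Mindex k \<and>
          infsum h (Mindex k) \<le> cmod a0 + (1 - (cmod a0)\<^sup>2) * ((\<Prod>i<k. 1 / (1 - r i)) - 1) \<and>
          ((\<Prod>i<k. 1 - r i) \<ge> 2/3 \<longrightarrow> infsum h (Mindex k) \<le> 1))) \<and>
    1 - (2/3) powr (1 / real k) \<le> bohr_radius k n \<and> bohr_radius k n \<le> 1/3"
proof (intro conjI allI impI)
  fix DK :: "nat set" and A :: "(nat \<Rightarrow> nat list) \<Rightarrow> nat mat" and a0 :: complex and r :: "nat \<Rightarrow> real"
    and D :: "nat set" and X :: "nat \<Rightarrow> nat \<Rightarrow> nat mat"
  assume *: "DK \<noteq> {} \<and> is_fh k n DK A \<and>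
       (\<forall>D' X'. polyball k n D' X' \<longrightarrow> mnorm (fh_eval k n A D' X') \<le> 1) \<and>
       A g0 = smul a0 (mid DK) \<and>
       (\<forall>i<k. 0 \<le> r i \<and> r i < 1) \<and>
       scaled_cl k n (\<lambda>i j. r i) D X"
  then have A0: "A g0 = smul a0 (mid DK)" and r: "\<forall>i<k. 0 \<le> r i \<and> r i < 1"
    and X: "scaled_cl k n (\<lambda>i j. r i) D X" by auto
  have bounded: "op_frame.bounded_series k n A 1"
    unfolding op_frame.bounded_series_def gterm_op
  proof (intro allI impI)
    fix D Y assume Y: "polyball k n D Y"
    then obtain S where S: "mconv (psums k n (fh_term k A D Y)) S"
      using * unfolding is_fh_def by blast
    have "mnorm S \<le> 1" using * Y fh_evalI[OF S] by metis
    then show "\<exists>S. mconv (psums k n (fh_term k A D Y)) S \<and> norm_bound S 1"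
      using S norm_bound_mono[OF mconvD(1)[OF S]] by blast
  qed
  have supp: "A \<alpha> u v = 0" if "u \<notin> DK \<or> v \<notin> DK" for \<alpha> u v
    using * that unfolding is_fh_def op_on_def by blast
  \<comment> \<open>A basis vector of K: on K = 0 the condition on \<open>A g0\<close> would not
    constrain a0.\<close>
  obtain u where u: "u \<in> DK" using * by blast
  have a0: "cmod a0 \<le> 1"
    by (rule op_frame.cmod_constant_le[OF bounded supp A0 polyball_point[of 0], of "(u, 0)"]) (auto simp: u)
  define h where "h = (\<lambda>p. mnorm (msum (Lam k n p) (fh_term k A D X)))"
  have maj: "h summable_on Mindex k"
    "infsum h (Mindex k) \<le> cmod a0 + (1 - (cmod a0)\<^sup>2) * ((\<Prod>i<k. 1 / (1 - r i)) - 1)"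
    using op_frame.majorant_series_bound[OF bounded supp A0 X a0 r] by (auto simp: gterm_op h_def)
  have "infsum h (Mindex k) \<le> 1" if "(\<Prod>i<k. 1 - r i) \<ge> 2/3"
  proof -
    have "(\<Prod>i<k. 1 / (1 - r i)) \<le> 3/2"
      using that by (simp add: prod_dividef field_simps)
    from bohr_inequality[OF norm_ge_zero a0 this] show ?thesis using maj(2) by simp
  qed
  with maj show "let h = (\<lambda>p. mnorm (msum (Lam k n p) (fh_term k A D X))) in
          h summable_on Mindex k \<and>
          infsum h (Mindex k) \<le> cmod a0 + (1 - (cmod a0)\<^sup>2) * ((\<Prod>i<k. 1 / (1 - r i)) - 1) \<and>
          ((\<Prod>i<k. 1 - r i) \<ge> 2/3 \<longrightarrow> infsum h (Mindex k) \<le> 1)"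
    unfolding Let_def h_def by blast
next
  \<comment> \<open>The root of (1 - r)^k = 2/3, the largest radius that
    \<open>bohr_ok_of_prod\<close> admits.\<close>
  define r where "r = 1 - (2/3) powr (1 / real k)"
  have k: "k \<ge> 1" "n 0 \<ge> 1" using assms by auto
  have "(2/3::real) powr (1 / real k) \<le> (2/3) powr 0"
    by (rule powr_mono') auto
  then have r: "0 \<le> r" "r < 1" by (auto simp: r_def)
  have "(1 - r) ^ k = (2/3) powr (1 / real k * real k)"
    by (simp add: r_def powr_powr powr_realpow[symmetric])
  then have "(1 - r) ^ k = 2/3" using k by simp
  then have ok: "bohr_ok k n r" using r by (intro bohr_ok_of_prod) auto
  \<comment> \<open>Also needed for the lower bound: without it the set of admissible radii might be
    unbounded and its \<open>Sup\<close> meaningless.\<close>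
  have third: "x \<le> 1/3" if "x \<in> {r. 0 \<le> r \<and> bohr_ok k n r}" for x
    using that bohr_ok_le_third[where n = n, OF k] by blast
  show "1 - (2/3) powr (1 / real k) \<le> bohr_radius k n"
    unfolding bohr_radius_def r_def[symmetric]
    using r ok third by (intro cSup_upper bdd_aboveI[of _ "1/3"]) auto
  show "bohr_radius k n \<le> 1/3"
    unfolding bohr_radius_def using r ok third by (intro cSup_least) auto
qed

end
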